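(* Let $\mathbb T\subset\mathbb R$ be a time scale and let $a,b\in\mathbb T$ with $a<b$. Suppose that $B_0$ and $B_1$ are reflexive Banach spaces and $B$ is a Banach space such that $B_0$ is compactly embedded in $B$ and $B$ is continuously embedded in $B_1$, and let $1<p_0,p_1<\infty$. Then the state projection $$\pi_0:\mathbb W_\Delta^{p_0,p_1}([a,b]_{\mathbb T};B_0,B_1)\longrightarrow L_\Delta^{p_0}([a,b)_{\mathbb T};B),\qquad \pi_0(u,z)=u,$$ is compact.
   Context: A time scale is a nonempty closed subset $\mathbb T\subset\mathbb R$. Write $[c,d)_{\mathbb T}=[c,d)\cap\mathbb T$. The Hilger measure $\mu_\Delta$ on $[a,b)_{\mathbb T}$ is the finite Borel measure characterized by $\mu_\Delta([c,d)\cap\mathbb T)=d-c$ for all $c,d\in\mathbb T$ with $a\le c<d\le b$. The delta integral $\int f(s)\,\Delta s$ is the (Bochner) integral with respect to $\mu_\Delta$, and $L_\Delta^p([a,b)_{\mathbb T};X)=L^p([a,b)_{\mathbb T},\mu_\Delta;X)$ is the Bochner space, for a Banach space $X$ and $1\le p<\infty$. The embeddings $i_{0B}:B_0\to B$ (compact) and $i_{B1}:B\to B_1$ (continuous) are fixed injective bounded linear maps, and $i_{01}=i_{B1}\circ i_{0B}$. The delta evolution graph $\mathbb W_\Delta^{p_0,p_1}([a,b]_{\mathbb T};B_0,B_1)$ is the set of pairs $(u,z)\in L_\Delta^{p_0}([a,b)_{\mathbb T};B_0)\times L_\Delta^{p_1}([a,b)_{\mathbb T};B_1)$ for which there exist $x\in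 B_1$ and $U:[a,b]\cap\mathbb T\to B_1$ such that $U(t)=i_{01}u(t)$ for $\mu_\Delta$-almost every $t\in[a,b)_{\mathbb T}$ and $$U(t)=x+\int_{[a,t)_{\mathbb T}}z(s)\,\Delta s,\qquad t\in[a,b]\cap\mathbb T.$$ It carries the norm $\|(u,z)\|=\|u\|_{L_\Delta^{p_0}(B_0)}+\|z\|_{L_\Delta^{p_1}(B_1)}$. In the target space $u$ is regarded as $B$-valued via $i_{0B}$. *)

theory Defs
  imports "HOL-Analysis.Analysis"
begin

section \<open>Reflexive spaces and compact maps\<close>

text \<open>Surjectivity of the canonical embedding into the bidual.\<close>

definition reflexive_space :: "'a::real_normed_vector itself \<Rightarrow> bool" where
  "reflexive_space _ \<longleftrightarrow>
     (\<forall>\<phi> :: ('a \<Rightarrow>\<^sub>L real) \<Rightarrow>\<^sub>L real. \<exists>x::'a. \<forall>f. blinfun_apply \<phi> f = blinfun_apply f x)"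

text \<open>A map from a normed carrier set into a topological space is compact if it sends norm-bounded
  sets to relatively compact ones.  Membership of the values in the target is required separately
  because \<open>closure_of\<close> discards points outside the topological space.\<close>

definition compact_map :: "'x set \<Rightarrow> ('x \<Rightarrow> real) \<Rightarrow> 'y topology \<Rightarrow> ('x \<Rightarrow> 'y) \<Rightarrow> bool" where
  "compact_map X nrm Y f \<longleftrightarrow>
     f \<in> X \<rightarrow> topspace Y \<and>
     (\<forall>S\<subseteq>X. (\<exists>C. \<forall>x\<in>S. nrm x \<le> C) \<longrightarrow> compactin Y (Y closure_of (f ` S)))"

section \<open>Bochner integration in arbitrary Banach spaces\<close>

text \<open>The Bochner integral of the library is restricted to second countable (separable) value
  spaces.  Strong measurability is taken modulo null sets.\<close>

definition strongly_measurable :: "'a measure \<Rightarrow> ('a \<Rightarrow> 'b::real_normed_vector) \<Rightarrow> bool" where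
  "strongly_measurable M f \<longleftrightarrow>
     (\<exists>s. (\<forall>i::nat. simple_function M (s i)) \<and> (AE x in M. (\<lambda>i. s i x) \<longlonglongrightarrow> f x))"

definition has_strong_integral ::
    "'a measure \<Rightarrow> ('a \<Rightarrow> 'b::real_normed_vector) \<Rightarrow> 'b \<Rightarrow> bool" where
  "has_strong_integral M f y \<longleftrightarrow>
     strongly_measurable M f \<and>
     (\<exists>s. (\<forall>i::nat. Bochner_Integration.simple_bochner_integrable M (s i)) \<and>
          (\<lambda>i. \<integral>\<^sup>+x. norm (f x - s i x) \<partial>M) \<longlonglongrightarrow> 0 \<and>
          (\<lambda>i. Bochner_Integration.simple_bochner_integral M (s i)) \<longlonglongrightarrow> y)"

definition strong_integral :: "'a measure \<Rightarrow> ('a \<Rightarrow> 'b::real_normed_vector) \<Rightarrow> 'b" where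
  "strong_integral M f = (THE y. has_strong_integral M f y)"

lemma strongly_measurable_norm:
  assumes "strongly_measurable M f"
  obtains g where "g \<in> borel_measurable M" "\<And>x. 0 \<le> g x" "AE x in M. norm (f x) = (g x :: real)"
proof -
  obtain s where s: "\<And>i::nat. simple_function M (s i)"
    and lim: "AE x in M. (\<lambda>i. s i x) \<longlonglongrightarrow> f x"
    using assms unfolding strongly_measurable_def by blast
  have m: "(\<lambda>x. norm (s i x)) \<in> borel_measurable M" for i
    by (rule borel_measurable_simple_function) (rule simple_function_compose1[OF s])
  define g where "g = (\<lambda>x. \<bar>lim (\<lambda>i. norm (s i x))\<bar>)"
  have "g \<in> borel_measurable M"
    unfolding g_def using borel_measurable_lim_metric[OF m] by measurable
  moreover have "AE x in M. norm (f x) = g x"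
    using lim
  proof eventually_elim
    case (elim x)
    then have "(\<lambda>i. norm (s i x)) \<longlonglongrightarrow> norm (f x)"
      by (rule tendsto_norm)
    then show ?case by (simp add: g_def limI)
  qed
  ultimately show ?thesis using that by (auto simp: g_def)
qed

lemma strongly_measurable_simple: "simple_function M f \<Longrightarrow> strongly_measurable M f"
  unfolding strongly_measurable_def by (intro exI[of _ "\<lambda>_. f"]) auto

lemma strongly_measurable_diff:
  assumes "strongly_measurable M f" "strongly_measurable M g"
  shows "strongly_measurable M (\<lambda>x. f x - g x)"
proof -
  obtain s where s: "\<And>i::nat. simple_function M (s i)"
    and ls: "AE x in M. (\<lambda>i. s i x) \<longlonglongrightarrow> f x"
    using assms unfolding strongly_measurable_def by blast
  obtain t where t: "\<And>i::nat. simple_function M (t i)"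
    and lt: "AE x in M. (\<lambda>i. t i x) \<longlonglongrightarrow> g x"
    using assms unfolding strongly_measurable_def by blast
  have "simple_function M (\<lambda>x. s i x - t i x)" for i
    by (rule simple_function_compose2[OF s t])
  moreover have "AE x in M. (\<lambda>i. s i x - t i x) \<longlonglongrightarrow> f x - g x"
    using ls lt by eventually_elim (rule tendsto_diff)
  ultimately show ?thesis
    unfolding strongly_measurable_def by (intro exI[of _ "\<lambda>i x. s i x - t i x"]) auto
qed

lemma nn_integral_norm_add:
  assumes "strongly_measurable M f" "strongly_measurable M g"
  shows "(\<integral>\<^sup>+x. ennreal (norm (f x)) + ennreal (norm (g x)) \<partial>M) =
    (\<integral>\<^sup>+x. norm (f x) \<partial>M) + (\<integral>\<^sup>+x. norm (g x) \<partial>M)"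
proof -
  obtain f' where f': "f' \<in> borel_measurable M" "AE x in M. norm (f x) = (f' x :: real)"
    using strongly_measurable_norm[OF assms(1)] by metis
  obtain g' where g': "g' \<in> borel_measurable M" "AE x in M. norm (g x) = (g' x :: real)"
    using strongly_measurable_norm[OF assms(2)] by metis
  have "(\<integral>\<^sup>+x. ennreal (norm (f x)) + ennreal (norm (g x)) \<partial>M) =
      (\<integral>\<^sup>+x. ennreal (f' x) + ennreal (g' x) \<partial>M)"
    by (rule nn_integral_cong_AE) (use f'(2) g'(2) in \<open>eventually_elim, simp\<close>)
  also have "\<dots> = (\<integral>\<^sup>+x. ennreal (f' x) \<partial>M) + (\<integral>\<^sup>+x. ennreal (g' x) \<partial>M)"
    using f'(1) g'(1) by (intro nn_integral_add) auto
  also have "(\<integral>\<^sup>+x. ennreal (f' x) \<partial>M) = (\<integral>\<^sup>+x. norm (f x) \<partial>M)"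
    by (rule nn_integral_cong_AE) (use f'(2) in \<open>eventually_elim, simp\<close>)
  also have "(\<integral>\<^sup>+x. ennreal (g' x) \<partial>M) = (\<integral>\<^sup>+x. norm (g x) \<partial>M)"
    by (rule nn_integral_cong_AE) (use g'(2) in \<open>eventually_elim, simp\<close>)
  finally show ?thesis .
qed

lemma simple_bochner_integral_dist:
  assumes f: "strongly_measurable M f"
    and s: "Bochner_Integration.simple_bochner_integrable M s" and t: "Bochner_Integration.simple_bochner_integrable M t"
  shows "ennreal (norm (Bochner_Integration.simple_bochner_integral M s - Bochner_Integration.simple_bochner_integral M t)) \<le>
    (\<integral>\<^sup>+ x. norm (f x - s x) \<partial>M) + (\<integral>\<^sup>+ x. norm (f x - t x) \<partial>M)"
proof -
  have sm: "strongly_measurable M s" "strongly_measurable M t"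
    using s t by (auto intro: strongly_measurable_simple elim: simple_bochner_integrable.cases)
  have "ennreal (norm (Bochner_Integration.simple_bochner_integral M s - Bochner_Integration.simple_bochner_integral M t)) =
      norm (Bochner_Integration.simple_bochner_integral M (\<lambda>x. s x - t x))"
    using s t by (subst simple_bochner_integral_diff) auto
  also have "\<dots> \<le> Bochner_Integration.simple_bochner_integral M (\<lambda>x. norm (s x - t x))"
    using simple_bochner_integrable_compose2[of "(-)" M "s" "t"] s t
    by (auto intro!: simple_bochner_integral_norm_bound)
  also have "\<dots> = (\<integral>\<^sup>+x. norm (s x - t x) \<partial>M)"
    using simple_bochner_integrable_compose2[of "\<lambda>x y. norm (x - y)" M "s" "t"] s t
    by (auto intro!: simple_bochner_integral_eq_nn_integral)
  also have "\<dots> \<le> (\<integral>\<^sup>+x. ennreal (norm (f x - s x)) + ennreal (norm (f x - t x)) \<partial>M)"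
  proof -
    have "norm (s x - t x) \<le> norm (f x - s x) + norm (f x - t x)" for x
      by (metis dual_order.refl norm_diff_triangle_le norm_minus_commute)
    then show ?thesis
      by (metis (mono_tags, lifting) ennreal_leI ennreal_plus nn_integral_mono norm_ge_zero)
  qed
  also have "\<dots> = (\<integral>\<^sup>+ x. norm (f x - s x) \<partial>M) + (\<integral>\<^sup>+ x. norm (f x - t x) \<partial>M)"
    by (intro nn_integral_norm_add strongly_measurable_diff f sm)
  finally show ?thesis .
qed

lemma has_strong_integral_unique:
  assumes "has_strong_integral M f x" "has_strong_integral M f y"
  shows "x = y"
proof -
  from assms(1) obtain s where f: "strongly_measurable M f"
    and s: "\<And>i::nat. Bochner_Integration.simple_bochner_integrable M (s i)"
    "(\<lambda>i. \<integral>\<^sup>+x. norm (f x - s i x) \<partial>M) \<longlonglongrightarrow> 0"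
    "(\<lambda>i. Bochner_Integration.simple_bochner_integral M (s i)) \<longlonglongrightarrow> x"
    unfolding has_strong_integral_def by blast
  from assms(2) obtain t where
    t: "\<And>i::nat. Bochner_Integration.simple_bochner_integrable M (t i)"
    "(\<lambda>i. \<integral>\<^sup>+x. norm (f x - t i x) \<partial>M) \<longlonglongrightarrow> 0"
    "(\<lambda>i. Bochner_Integration.simple_bochner_integral M (t i)) \<longlonglongrightarrow> y"
    unfolding has_strong_integral_def by blast
  have "(\<lambda>i. ennreal (norm (Bochner_Integration.simple_bochner_integral M (s i) - Bochner_Integration.simple_bochner_integral M (t i))))
      \<longlonglongrightarrow> 0"
  proof (rule tendsto_sandwich[where f = "\<lambda>_. 0"])
    show "(\<lambda>i. (\<integral>\<^sup>+x. norm (f x - s i x) \<partial>M) + (\<integral>\<^sup>+x. norm (f x - t i x) \<partial>M)) \<longlonglongrightarrow> (0::ennreal)"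
      using tendsto_add[OF s(2) t(2)] by simp
    show "\<forall>\<^sub>F i in sequentially.
        ennreal (norm (Bochner_Integration.simple_bochner_integral M (s i) - Bochner_Integration.simple_bochner_integral M (t i))) \<le>
        (\<integral>\<^sup>+x. norm (f x - s i x) \<partial>M) + (\<integral>\<^sup>+x. norm (f x - t i x) \<partial>M)"
      by (intro always_eventually allI simple_bochner_integral_dist f s t)
  qed auto
  then have "(\<lambda>i. norm (Bochner_Integration.simple_bochner_integral M (s i) - Bochner_Integration.simple_bochner_integral M (t i))) \<longlonglongrightarrow> 0"
    by (simp flip: ennreal_0)
  moreover have "(\<lambda>i. norm (Bochner_Integration.simple_bochner_integral M (s i) - Bochner_Integration.simple_bochner_integral M (t i)))
      \<longlonglongrightarrow> norm (x - y)"
    by (intro tendsto_norm tendsto_diff s t)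
  ultimately have "norm (x - y) = 0"
    using LIMSEQ_unique by blast
  then show ?thesis by simp
qed

lemma strong_integral_eq: "has_strong_integral M f y \<Longrightarrow> strong_integral M f = y"
  unfolding strong_integral_def using has_strong_integral_unique by blast

lemma has_strong_integral_exists:
  fixes f :: "'a \<Rightarrow> 'b::banach"
  assumes f: "strongly_measurable M f" and fin: "(\<integral>\<^sup>+x. norm (f x) \<partial>M) < \<infinity>"
  shows "has_strong_integral M f (strong_integral M f)"
proof -
  obtain s where s: "\<And>i::nat. simple_function M (s i)"
    and lim: "AE x in M. (\<lambda>i. s i x) \<longlonglongrightarrow> f x"
    using f unfolding strongly_measurable_def by blast
  obtain g where g[measurable]: "g \<in> borel_measurable M" and g0: "\<And>x. 0 \<le> g x"
    and fg: "AE x in M. norm (f x) = (g x :: real)"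
    using strongly_measurable_norm[OF f] by metis
  have gfin: "(\<integral>\<^sup>+x. g x \<partial>M) < \<infinity>"
  proof -
    have "(\<integral>\<^sup>+x. norm (f x) \<partial>M) = (\<integral>\<^sup>+x. g x \<partial>M)"
      by (rule nn_integral_cong_AE) (use fg in \<open>eventually_elim, simp\<close>)
    then show ?thesis using fin by simp
  qed
  have ns[measurable]: "(\<lambda>x. norm (s i x)) \<in> borel_measurable M" for i
    by (rule borel_measurable_simple_function) (rule simple_function_compose1[OF s])
  define A where "A i = {x\<in>space M. norm (s i x) \<le> 2 * g x}" for i
  have A[measurable]: "A i \<in> sets M" for i unfolding A_def by measurable
  define t where "t i x = indicator (A i) x *\<^sub>R s i x" for i x
  have simp_t: "simple_function M (t i)" for i
    unfolding t_def
    by (rule simple_function_compose2[OF simple_function_indicator[OF A] s])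
  have bt: "norm (t i x) \<le> 2 * g x" for i x
    using g0[of x] s by (cases "x \<in> space M")
      (auto simp: t_def A_def indicator_def)
  have tint: "Bochner_Integration.simple_bochner_integrable M (t i)" for i
  proof (rule simple_bochner_integrableI_bounded[OF simp_t])
    have "(\<integral>\<^sup>+x. norm (t i x) \<partial>M) \<le> (\<integral>\<^sup>+x. ennreal (2 * g x) \<partial>M)"
      using bt[of i] by (intro nn_integral_mono ennreal_leI)
    also have "\<dots> = (\<integral>\<^sup>+x. ennreal 2 * ennreal (g x) \<partial>M)"
      by (intro nn_integral_cong) (rule ennreal_mult'[of 2], simp)
    also have "\<dots> = ennreal 2 * (\<integral>\<^sup>+x. g x \<partial>M)"
      by (intro nn_integral_cmult) measurable
    also have "\<dots> < \<infinity>" using gfin by (simp add: ennreal_mult_less_top)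
    finally show "(\<integral>\<^sup>+x. norm (t i x) \<partial>M) < \<infinity>" .
  qed
  have limt: "AE x in M. (\<lambda>i. t i x) \<longlonglongrightarrow> f x"
    using lim fg AE_space
  proof eventually_elim
    case (elim x)
    show ?case
    proof (cases "f x = 0")
      case True
      then have "t i x = 0" for i
        using elim by (auto simp: t_def A_def indicator_def)
      then show ?thesis using True by simp
    next
      case False
      have "(\<lambda>i. norm (s i x)) \<longlonglongrightarrow> norm (f x)"
        using elim(1) by (rule tendsto_norm)
      moreover have "norm (f x) < 2 * g x" using False elim(2) zero_less_norm_iff[of "f x"] by linarith
      ultimately have "\<forall>\<^sub>F i in sequentially. norm (s i x) < 2 * g x"
        by (rule order_tendstoD)
      then have "\<forall>\<^sub>F i in sequentially. s i x = t i x"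
        using elim(3) by (auto elim!: eventually_mono simp: t_def A_def)
      with elim(1) show ?thesis by (rule Lim_transform_eventually)
    qed
  qed
  have conv: "(\<lambda>i. \<integral>\<^sup>+x. norm (f x - t i x) \<partial>M) \<longlonglongrightarrow> 0"
  proof -
    have "\<exists>h. h \<in> borel_measurable M \<and> (AE x in M. norm (f x - t i x) = (h x :: real))" for i
      using strongly_measurable_norm[OF strongly_measurable_diff[OF f strongly_measurable_simple[OF simp_t]]]
      by metis
    then obtain h where h[measurable]: "\<And>i. h i \<in> borel_measurable M"
      and fh: "\<And>i. AE x in M. norm (f x - t i x) = (h i x :: real)"
      by metis
    have fh': "AE x in M. \<forall>i. norm (f x - t i x) = h i x"
      using fh by (simp add: AE_all_countable)
    have "(\<lambda>i. \<integral>\<^sup>+x. ennreal (h i x) \<partial>M) \<longlonglongrightarrow> (\<integral>\<^sup>+x. 0 \<partial>M)"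
    proof (rule nn_integral_dominated_convergence[where w = "\<lambda>x. ennreal (3 * g x)"])
      show "AE x in M. ennreal (h j x) \<le> ennreal (3 * g x)" for j
        using fh[of j] fg
      proof eventually_elim
        case (elim x)
        have "norm (f x - t j x) \<le> norm (f x) + norm (t j x)" by (rule norm_triangle_ineq4)
        then show ?case using bt[of j x] elim by (intro ennreal_leI) simp
      qed
      have "(\<integral>\<^sup>+x. ennreal (3 * g x) \<partial>M) = (\<integral>\<^sup>+x. ennreal 3 * ennreal (g x) \<partial>M)"
        by (intro nn_integral_cong) (rule ennreal_mult'[of 3], simp)
      also have "\<dots> = ennreal 3 * (\<integral>\<^sup>+x. g x \<partial>M)"
        by (intro nn_integral_cmult) measurable
      also have "\<dots> < \<infinity>" using gfin by (simp add: ennreal_mult_less_top)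
      finally show "(\<integral>\<^sup>+x. ennreal (3 * g x) \<partial>M) < \<infinity>" .
      show "AE x in M. (\<lambda>i. ennreal (h i x)) \<longlonglongrightarrow> 0"
        using fh' limt
      proof eventually_elim
        case (elim x)
        have "(\<lambda>i. norm (f x - t i x)) \<longlonglongrightarrow> norm (f x - f x)"
          by (intro tendsto_intros elim)
        then have "(\<lambda>i. h i x) \<longlonglongrightarrow> 0" using elim(1) by simp
        then have "(\<lambda>i. ennreal (h i x)) \<longlonglongrightarrow> ennreal 0" by (rule tendsto_ennrealI)
        then show ?case by simp
      qed
    qed measurable
    moreover have "(\<integral>\<^sup>+x. norm (f x - t i x) \<partial>M) = (\<integral>\<^sup>+x. ennreal (h i x) \<partial>M)" for i
      by (rule nn_integral_cong_AE) (use fh[of i] in \<open>eventually_elim, simp\<close>)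
    ultimately show ?thesis by simp
  qed
  have "Cauchy (\<lambda>i. Bochner_Integration.simple_bochner_integral M (t i))"
    unfolding Cauchy_def
  proof (intro allI impI)
    fix e :: real assume "0 < e"
    then have "\<forall>\<^sub>F i in sequentially. (\<integral>\<^sup>+x. norm (f x - t i x) \<partial>M) < ennreal (e / 2)"
      by (intro order_tendstoD(2)[OF conv]) simp
    then obtain N where N: "\<And>i. i \<ge> N \<Longrightarrow> (\<integral>\<^sup>+x. norm (f x - t i x) \<partial>M) < ennreal (e / 2)"
      by (auto simp: eventually_sequentially)
    show "\<exists>N. \<forall>m\<ge>N. \<forall>n\<ge>N.
        dist (Bochner_Integration.simple_bochner_integral M (t m)) (Bochner_Integration.simple_bochner_integral M (t n)) < e"
    proof (intro exI allI impI)
      fix m n assume mn: "m \<ge> N" "n \<ge> N"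
      have "ennreal (norm (Bochner_Integration.simple_bochner_integral M (t m) - Bochner_Integration.simple_bochner_integral M (t n))) \<le>
          (\<integral>\<^sup>+x. norm (f x - t m x) \<partial>M) + (\<integral>\<^sup>+x. norm (f x - t n x) \<partial>M)"
        by (intro simple_bochner_integral_dist f tint)
      also have "\<dots> < ennreal (e/2) + ennreal (e/2)"
        by (intro add_strict_mono N mn)
      also have "\<dots> = ennreal e" using \<open>0 < e\<close> by (simp flip: ennreal_plus)
      finally show "dist (Bochner_Integration.simple_bochner_integral M (t m)) (Bochner_Integration.simple_bochner_integral M (t n)) < e"
        using \<open>0 < e\<close> by (simp add: dist_norm ennreal_less_iff)
    qed
  qed
  then obtain y where "(\<lambda>i. Bochner_Integration.simple_bochner_integral M (t i)) \<longlonglongrightarrow> y"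
    using Cauchy_convergent convergent_def by blast
  then have "has_strong_integral M f y"
    unfolding has_strong_integral_def using f tint conv by blast
  then show ?thesis using strong_integral_eq by metis
qed

section \<open>Bochner spaces\<close>

text \<open>Elements of the Bochner space are classes of functions modulo equality almost everywhere.
  The choice of representatives below is immaterial.\<close>

definition ae_class :: "'a measure \<Rightarrow> ('a \<Rightarrow> 'b) \<Rightarrow> ('a \<Rightarrow> 'b) set" where
  "ae_class M f = {g. AE x in M. g x = f x}"

definition class_rep :: "('a \<Rightarrow> 'b) set \<Rightarrow> 'a \<Rightarrow> 'b" where
  "class_rep F = (SOME f. f \<in> F)"

definition p_integral :: "'a measure \<Rightarrow> real \<Rightarrow> ('a \<Rightarrow> 'b::real_normed_vector) \<Rightarrow> ennreal" where
  "p_integral M p f = (\<integral>\<^sup>+x. ennreal (norm (f x) powr p) \<partial>M)"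

definition p_norm :: "'a measure \<Rightarrow> real \<Rightarrow> ('a \<Rightarrow> 'b::real_normed_vector) \<Rightarrow> real" where
  "p_norm M p f = enn2real (p_integral M p f) powr (1 / p)"

definition Lp_space :: "'a measure \<Rightarrow> real \<Rightarrow> ('a \<Rightarrow> 'b::banach) set set" where
  "Lp_space M p = {ae_class M f | f. strongly_measurable M f \<and> p_integral M p f < \<infinity>}"

definition Lp_norm :: "'a measure \<Rightarrow> real \<Rightarrow> ('a \<Rightarrow> 'b::banach) set \<Rightarrow> real" where
  "Lp_norm M p F = p_norm M p (class_rep F)"

definition Lp_dist :: "'a measure \<Rightarrow> real \<Rightarrow> ('a \<Rightarrow> 'b::banach) set \<Rightarrow> ('a \<Rightarrow> 'b) set \<Rightarrow> real" where
  "Lp_dist M p F G = p_norm M p (\<lambda>x. class_rep F x - class_rep G x)"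

definition Lp_topology :: "'a measure \<Rightarrow> real \<Rightarrow> ('a \<Rightarrow> 'b::banach) set topology" where
  "Lp_topology M p = Metric_space.mtopology (Lp_space M p) (Lp_dist M p)"

lemma p_norm_cong_AE: "AE x in M. f x = g x \<Longrightarrow> p_norm M p f = p_norm M p g"
proof -
  assume *: "AE x in M. f x = g x"
  have "p_integral M p f = p_integral M p g"
    unfolding p_integral_def
    by (rule nn_integral_cong_AE) (use * in \<open>eventually_elim, simp\<close>)
  then show ?thesis by (simp add: p_norm_def)
qed

lemma class_rep_AE: "AE x in M. class_rep (ae_class M f) x = f x"
proof -
  have "f \<in> ae_class M f" by (simp add: ae_class_def)
  then have "class_rep (ae_class M f) \<in> ae_class M f"
    unfolding class_rep_def by (rule someI[of "\<lambda>g. g \<in> ae_class M f"])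
  then show ?thesis by (simp add: ae_class_def)
qed

lemma ae_class_eq_iff: "ae_class M f = ae_class M g \<longleftrightarrow> (AE x in M. f x = g x)"
proof
  assume "ae_class M f = ae_class M g"
  then have "f \<in> ae_class M g" by (auto simp: ae_class_def)
  then show "AE x in M. f x = g x" by (simp add: ae_class_def)
next
  assume fg: "AE x in M. f x = g x"
  show "ae_class M f = ae_class M g"
    unfolding ae_class_def
  proof (rule Collect_cong, rule iffI)
    fix h assume "AE x in M. h x = f x"
    with fg show "AE x in M. h x = g x" by eventually_elim simp
  next
    fix h assume "AE x in M. h x = g x"
    with fg show "AE x in M. h x = f x" by eventually_elim simp
  qed
qed

lemma Lp_norm_ae_class: "Lp_norm M p (ae_class M f) = p_norm M p f"
  unfolding Lp_norm_def by (rule p_norm_cong_AE, rule class_rep_AE)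

lemma Lp_dist_ae_class:
  "Lp_dist M p (ae_class M f) (ae_class M g) = p_norm M p (\<lambda>x. f x - g x)"
  unfolding Lp_dist_def
  by (rule p_norm_cong_AE)
     (use class_rep_AE[of M f] class_rep_AE[of M g] in \<open>eventually_elim, simp\<close>)

lemma strongly_measurable_powr:
  assumes "strongly_measurable M f"
  obtains g where "g \<in> borel_measurable M" "\<And>x. 0 \<le> g x"
    "AE x in M. norm (f x) powr p = (g x :: real)"
proof -
  obtain h where h[measurable]: "h \<in> borel_measurable M" and "\<And>x. 0 \<le> h x"
    and *: "AE x in M. norm (f x) = (h x :: real)"
    using strongly_measurable_norm[OF assms] by metis
  have "(\<lambda>x. h x powr p) \<in> borel_measurable M" by measurable
  moreover have "AE x in M. norm (f x) powr p = h x powr p"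
    using * by eventually_elim simp
  ultimately show ?thesis using that[of "\<lambda>x. h x powr p"] by simp
qed

lemma convex_on_powr_nonneg:
  fixes p :: real
  assumes p: "1 \<le> p"
  shows "convex_on {0..} (\<lambda>x::real. x powr p)"
proof (rule convex_onI)
  fix t x y :: real
  assume t: "0 < t" "t < 1" and xy: "x \<in> {0..}" "y \<in> {0..}"
  have le1: "u powr p \<le> u" if "0 \<le> u" "u \<le> 1" for u :: real
    using powr_mono'[of 1 p u] that p by (cases "u = 0") auto
  consider "x = 0" | "y = 0" | "0 < x" "0 < y" using xy by force
  then show "((1 - t) *\<^sub>R x + t *\<^sub>R y) powr p \<le> (1 - t) * x powr p + t * y powr p"
  proof cases
    case 1
    then show ?thesis
      using le1[of t] t xy by (simp add: powr_mult mult_right_mono)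
  next
    case 2
    then show ?thesis
      using le1[of "1 - t"] t xy by (simp add: powr_mult mult_right_mono)
  next
    case 3
    then show ?thesis
      using convex_onD[OF powr_convex[OF p], of t x y] t by simp
  qed
qed (rule convex_real_interval)

lemma powr_add_le:
  fixes x y a b :: real
  assumes "0 \<le> x" "0 \<le> y" "0 < a" "0 < b" "1 \<le> p"
  shows "(x + y) powr p \<le> (a + b) powr (p - 1) * (a powr (1 - p) * x powr p + b powr (1 - p) * y powr p)"
proof -
  have cv: "convex_on {0..} (\<lambda>x::real. x powr p)"
    by (rule convex_on_powr_nonneg) (use assms in auto)
  have "((a / (a+b)) * (x / a) + (b / (a+b)) * (y / b)) powr p \<le>
      (a / (a+b)) * (x / a) powr p + (b / (a+b)) * (y / b) powr p"
    using convex_onD[OF cv, of "b / (a+b)" "x / a" "y / b"] assms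
    by (simp add: field_simps)
  also have "(a / (a+b)) * (x / a) + (b / (a+b)) * (y / b) = (x + y) / (a + b)"
    using assms by (simp add: add_divide_distrib)
  finally have *: "(x + y) powr p / (a + b) powr p \<le>
      (a / (a+b)) * (x powr p / a powr p) + (b / (a+b)) * (y powr p / b powr p)"
    using assms by (simp add: powr_divide)
  have "(x + y) powr p = (a + b) powr p * ((x + y) powr p / (a + b) powr p)"
    using assms by simp
  also have "\<dots> \<le> (a + b) powr p *
      ((a / (a+b)) * (x powr p / a powr p) + (b / (a+b)) * (y powr p / b powr p))"
    by (intro mult_left_mono *) auto
  also have "\<dots> = (a + b) powr p / (a + b) *
      (a / a powr p * x powr p + b / b powr p * y powr p)"
    by (simp add: distrib_left mult_ac)
  also have "\<dots> = (a + b) powr (p - 1) *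
      (a powr (1 - p) * x powr p + b powr (1 - p) * y powr p)"
    using assms by (simp add: powr_diff)
  finally show ?thesis .
qed

lemma p_norm_powr:
  assumes "1 \<le> p" "p_integral M p f < \<infinity>"
  shows "p_integral M p f = ennreal (p_norm M p f powr p)"
  using assms by (simp add: p_norm_def powr_powr)

lemma p_integral_add_le:
  assumes f: "strongly_measurable M f" and g: "strongly_measurable M g"
    and p: "1 \<le> p" and fin: "p_integral M p f < \<infinity>" "p_integral M p g < \<infinity>"
    and a: "p_norm M p f < a" and b: "p_norm M p g < b"
    and le: "AE x in M. norm (h x) \<le> norm (f x) + norm (g x)"
  shows "p_integral M p h \<le> ennreal ((a + b) powr p)"
proof -
  have pos: "0 < a" "0 < b"
    using a b by (auto simp: p_norm_def intro: le_less_trans[rotated])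
  obtain f' where f'[measurable]: "f' \<in> borel_measurable M" and f0: "\<And>x. 0 \<le> f' x"
    and ff: "AE x in M. norm (f x) powr p = (f' x :: real)"
    using strongly_measurable_powr[OF f] by metis
  obtain g' where g'[measurable]: "g' \<in> borel_measurable M" and g0: "\<And>x. 0 \<le> g' x"
    and gg: "AE x in M. norm (g x) powr p = (g' x :: real)"
    using strongly_measurable_powr[OF g] by metis
  define c where "c = (a + b) powr (p - 1)"
  define u where "u = a powr (1 - p)"
  define v where "v = b powr (1 - p)"
  have nn: "0 \<le> c" "0 \<le> u" "0 \<le> v" by (auto simp: c_def u_def v_def)
  have "p_integral M p h \<le> (\<integral>\<^sup>+x. ennreal (c * u) * ennreal (f' x) + ennreal (c * v) * ennreal (g' x) \<partial>M)"
    unfolding p_integral_def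
  proof (rule nn_integral_mono_AE, use le ff gg in eventually_elim)
    case (elim x)
    have "norm (h x) powr p \<le> (norm (f x) + norm (g x)) powr p"
      using elim p by (intro powr_mono2) auto
    also have "\<dots> \<le> c * (u * norm (f x) powr p + v * norm (g x) powr p)"
      unfolding c_def u_def v_def using pos p by (intro powr_add_le) auto
    also have "\<dots> = (c * u) * f' x + (c * v) * g' x"
      using elim by (simp add: algebra_simps)
    finally show ?case
      using nn f0[of x] g0[of x] by (simp flip: ennreal_mult ennreal_plus)
  qed
  also have "\<dots> = ennreal (c * u) * (\<integral>\<^sup>+x. f' x \<partial>M) + ennreal (c * v) * (\<integral>\<^sup>+x. g' x \<partial>M)"
    by (simp add: nn_integral_add nn_integral_cmult)
  also have "(\<integral>\<^sup>+x. f' x \<partial>M) = p_integral M p f"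
    unfolding p_integral_def by (rule nn_integral_cong_AE) (use ff in \<open>eventually_elim, simp\<close>)
  also have "(\<integral>\<^sup>+x. g' x \<partial>M) = p_integral M p g"
    unfolding p_integral_def by (rule nn_integral_cong_AE) (use gg in \<open>eventually_elim, simp\<close>)
  also have "ennreal (c * u) * p_integral M p f + ennreal (c * v) * p_integral M p g
      \<le> ennreal (c * u) * ennreal (a powr p) + ennreal (c * v) * ennreal (b powr p)"
    unfolding p_norm_powr[OF p fin(1)] p_norm_powr[OF p fin(2)]
    using a b p by (intro add_mono mult_left_mono ennreal_leI powr_mono2) (auto simp: p_norm_def)
  also have "\<dots> = ennreal (c * (u * a powr p + v * b powr p))"
    using nn by (simp add: distrib_left mult.assoc flip: ennreal_mult ennreal_plus)
  also have "c * (u * a powr p + v * b powr p) = (a + b) powr p"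
    using pos by (simp add: c_def u_def v_def powr_diff field_simps)
  finally show ?thesis .
qed

lemma p_norm_add_le:
  assumes f: "strongly_measurable M f" and g: "strongly_measurable M g"
    and p: "1 \<le> p" and fin: "p_integral M p f < \<infinity>" "p_integral M p g < \<infinity>"
    and le: "AE x in M. norm (h x) \<le> norm (f x) + norm (g x)"
  shows "p_integral M p h < \<infinity>" "p_norm M p h \<le> p_norm M p f + p_norm M p g"
proof -
  have *: "p_integral M p h \<le> ennreal ((p_norm M p f + e + (p_norm M p g + e)) powr p)"
    if "0 < e" for e
    using that by (intro p_integral_add_le[OF f g p fin _ _ le]) auto
  show fh: "p_integral M p h < \<infinity>"
    using *[of 1] by (auto intro: le_less_trans)
  show "p_norm M p h \<le> p_norm M p f + p_norm M p g"
  proof (rule field_le_epsilon)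
    fix e :: real assume e: "0 < e"
    have nn: "0 \<le> p_norm M p f" "0 \<le> p_norm M p g" by (auto simp: p_norm_def)
    have "ennreal (p_norm M p h powr p) \<le> ennreal ((p_norm M p f + p_norm M p g + e) powr p)"
      using *[of "e/2"] e p_norm_powr[OF p fh] by (simp add: algebra_simps)
    then have "p_norm M p h powr p \<le> (p_norm M p f + p_norm M p g + e) powr p"
      by simp
    then show "p_norm M p h \<le> p_norm M p f + p_norm M p g + e"
      using powr_less_mono2[of p "p_norm M p f + p_norm M p g + e" "p_norm M p h"] p nn e
      by (meson add_nonneg_nonneg less_eq_real_def less_le_trans not_less zero_less_one)
  qed
qed

lemma p_norm_eq_0:
  assumes f: "strongly_measurable M f" and p: "1 \<le> p" and fin: "p_integral M p f < \<infinity>"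
  shows "p_norm M p f = 0 \<longleftrightarrow> (AE x in M. f x = 0)"
proof -
  obtain f' where f'[measurable]: "f' \<in> borel_measurable M" and f0: "\<And>x. 0 \<le> f' x"
    and ff: "AE x in M. norm (f x) powr p = (f' x :: real)"
    using strongly_measurable_powr[OF f] by metis
  have eq: "p_integral M p f = (\<integral>\<^sup>+x. f' x \<partial>M)"
    unfolding p_integral_def by (rule nn_integral_cong_AE) (use ff in \<open>eventually_elim, simp\<close>)
  have "p_norm M p f = 0 \<longleftrightarrow> p_integral M p f = 0"
    using fin p by (auto simp: p_norm_def enn2real_eq_0_iff)
  also have "\<dots> \<longleftrightarrow> (AE x in M. ennreal (f' x) = 0)"
    unfolding eq by (rule nn_integral_0_iff_AE) measurable
  also have "\<dots> \<longleftrightarrow> (AE x in M. f x = 0)"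
  proof
    assume "AE x in M. ennreal (f' x) = 0"
    with ff show "AE x in M. f x = 0"
    proof eventually_elim
      case (elim x)
      then have "f' x = 0" using f0[of x] by (simp add: ennreal_eq_0_iff)
      then show ?case using elim(1) by simp
    qed
  next
    assume "AE x in M. f x = 0"
    with ff show "AE x in M. ennreal (f' x) = 0" by eventually_elim simp
  qed
  finally show ?thesis .
qed

lemma Lp_diff:
  assumes "strongly_measurable M f" "p_integral M p f < \<infinity>"
    "strongly_measurable M g" "p_integral M p g < \<infinity>" "1 \<le> p"
  shows "strongly_measurable M (\<lambda>x. f x - g x)" "p_integral M p (\<lambda>x. f x - g x) < \<infinity>"
proof -
  show "strongly_measurable M (\<lambda>x. f x - g x)" by (intro strongly_measurable_diff assms)
  show "p_integral M p (\<lambda>x. f x - g x) < \<infinity>"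
    by (rule p_norm_add_le(1)[OF assms(1,3,5,2,4)]) (simp add: norm_triangle_ineq4)
qed

lemma Metric_space_Lp:
  assumes p: "1 \<le> p"
  shows "Metric_space (Lp_space M p) (Lp_dist M p :: ('a \<Rightarrow> 'b::banach) set \<Rightarrow> _)"
proof
  fix F G H :: "('a \<Rightarrow> 'b) set"
  show "0 \<le> Lp_dist M p F G" by (simp add: Lp_dist_def p_norm_def)
  show "Lp_dist M p F G = Lp_dist M p G F"
    by (simp add: Lp_dist_def p_norm_def p_integral_def norm_minus_commute)
  assume "F \<in> Lp_space M p" "G \<in> Lp_space M p"
  then obtain f g where F: "F = ae_class M f" "strongly_measurable M f" "p_integral M p f < \<infinity>"
    and G: "G = ae_class M g" "strongly_measurable M g" "p_integral M p g < \<infinity>"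
    unfolding Lp_space_def by blast
  note fg = Lp_diff[OF F(2,3) G(2,3) p]
  show "Lp_dist M p F G = 0 \<longleftrightarrow> F = G"
    using p_norm_eq_0[OF fg(1) p fg(2)] by (simp add: F(1) G(1) Lp_dist_ae_class ae_class_eq_iff)
  assume "H \<in> Lp_space M p"
  then obtain h where H: "H = ae_class M h" "strongly_measurable M h" "p_integral M p h < \<infinity>"
    unfolding Lp_space_def by blast
  note gh = Lp_diff[OF G(2,3) H(2,3) p]
  have "norm (f x - h x) \<le> norm (f x - g x) + norm (g x - h x)" for x
    using norm_triangle_ineq[of "f x - g x" "g x - h x"] by simp
  then show "Lp_dist M p F H \<le> Lp_dist M p F G + Lp_dist M p G H"
    unfolding F(1) G(1) H(1) Lp_dist_ae_class
    by (intro p_norm_add_le(2) fg gh p AE_I2)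
qed

section \<open>Time scales and the Hilger measure\<close>

definition time_scale :: "real set \<Rightarrow> bool" where
  "time_scale T \<longleftrightarrow> T \<noteq> {} \<and> closed T"

definition is_hilger_measure :: "real set \<Rightarrow> real \<Rightarrow> real \<Rightarrow> real measure \<Rightarrow> bool" where
  "is_hilger_measure T a b M \<longleftrightarrow>
     sets M = sets (restrict_space borel ({a..<b} \<inter> T)) \<and> finite_measure M \<and>
     (\<forall>c\<in>T. \<forall>d\<in>T. a \<le> c \<and> c < d \<and> d \<le> b \<longrightarrow> emeasure M ({c..<d} \<inter> T) = ennreal (d - c))"

text \<open>Existence: push Lebesgue measure on \<open>[a,b)\<close> forward along \<open>s \<mapsto> sup {t \<in> T. t \<le> s}\<close>.\<close>

lemma hilger_measure_exists:
  assumes T: "closed T" and ab: "a \<in> T" "b \<in> T" "a < b"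
  shows "\<exists>M. is_hilger_measure T a b M"
proof -
  define r where "r s = Sup (T \<inter> {..s})" for s :: real
  have bdd: "bdd_above (T \<inter> {..s})" for s by (auto intro!: bdd_aboveI[of _ s])
  have ne: "T \<inter> {..s} \<noteq> {}" if "a \<le> s" for s using ab(1) that by auto
  have rin: "r s \<in> T \<inter> {..s}" if "a \<le> s" for s
    unfolding r_def using ne[OF that] bdd T by (intro closed_contains_Sup closed_Int) auto
  have rub: "t \<le> r s" if "t \<in> T" "t \<le> s" for s t
    unfolding r_def using that bdd by (intro cSup_upper) auto
  have mono: "mono_on {a..<b} r"
    by (intro mono_onI) (use rin rub in force)
  define N where "N = restrict_space lborel {a..<b}"
  define S where "S = restrict_space borel ({a..<b} \<inter> T)"
  have spN: "space N = {a..<b}" by (simp add: N_def space_restrict_space)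
  have "r \<in> borel_measurable N"
    using borel_measurable_mono_on_fnc[OF mono] unfolding N_def
    by (simp cong: measurable_cong_sets sets_restrict_space_cong)
  moreover have rsp: "r \<in> space N \<rightarrow> {a..<b} \<inter> T"
    using rin rub[OF ab(1)] by (force simp: spN)
  ultimately have r[measurable]: "r \<in> measurable N S"
    unfolding S_def by (intro measurable_restrict_space2) auto
  have em: "emeasure (distr N S r) ({c..<d} \<inter> T) = ennreal (d - c)"
    if "c \<in> T" "d \<in> T" "a \<le> c" "c < d" "d \<le> b" for c d
  proof -
    have "{c..<d} \<inter> T = ({a..<b} \<inter> T) \<inter> {c..<d}" using that by auto
    then have "{c..<d} \<inter> T \<in> sets S" by (auto simp: S_def sets_restrict_space)
    then have "emeasure (distr N S r) ({c..<d} \<inter> T) = emeasure N (r -` ({c..<d} \<inter> T) \<inter> space N)"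
      by (intro emeasure_distr r)
    also have "r -` ({c..<d} \<inter> T) \<inter> space N = {c..<d}"
    proof (intro set_eqI iffI)
      fix s assume "s \<in> r -` ({c..<d} \<inter> T) \<inter> space N"
      then have s: "c \<le> r s" "r s < d" "a \<le> s" by (auto simp: spN)
      then show "s \<in> {c..<d}" using rin[of s] rub[OF that(2), of s] by force
    next
      fix s assume "s \<in> {c..<d}"
      then show "s \<in> r -` ({c..<d} \<inter> T) \<inter> space N"
        using rin[of s] rub[OF that(1), of s] that by (auto simp: spN)
    qed
    also have "emeasure N {c..<d} = emeasure lborel {c..<d}"
      unfolding N_def using that by (intro emeasure_restrict_space) auto
    also have "\<dots> = ennreal (d - c)" using that by simp
    finally show ?thesis .
  qed
  have "emeasure (distr N S r) (space (distr N S r)) = ennreal (b - a)"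
    using em[OF ab(1,2)] ab by (simp add: S_def space_restrict_space)
  then have "finite_measure (distr N S r)" by (intro finite_measureI) simp
  with em show ?thesis
    by (intro exI[of _ "distr N S r"]) (auto simp: is_hilger_measure_def S_def)
qed

lemma hilger_measure_unique:
  assumes T: "closed T" and ab: "a \<in> T" "b \<in> T" "a < b"
    and M: "is_hilger_measure T a b M" and N: "is_hilger_measure T a b N"
  shows "M = N"
proof -
  define W where "W = {a..<b} \<inter> T"
  define E where "E = insert {} {{c..<d} \<inter> T | c d. c \<in> T \<and> d \<in> T \<and> a \<le> c \<and> c < d \<and> d \<le> b}"
  have EW: "E \<subseteq> Pow W" by (auto simp: E_def W_def)
  have WE: "W \<in> E" using ab by (auto simp: E_def W_def)
  have gen: "sets (restrict_space borel W) = sigma_sets W E"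
  proof
    have "E \<subseteq> sets (restrict_space borel W)"
    proof
      fix X assume "X \<in> E"
      then have "X = {} \<or> (\<exists>c d. X = W \<inter> {c..<d})"
        by (force simp: E_def W_def)
      then show "X \<in> sets (restrict_space borel W)"
        by (auto simp: sets_restrict_space)
    qed
    then show "sigma_sets W E \<subseteq> sets (restrict_space borel W)"
      using sets.sigma_sets_subset[of E "restrict_space borel W"] by (simp add: space_restrict_space)
    have ray: "{..<x} \<inter> W \<in> E" for x
    proof (cases "x \<le> b \<and> a < x")
      case True
      define d where "d = Inf (T \<inter> {x..})"
      have bdd: "bdd_below (T \<inter> {x..})" by (auto intro!: bdd_belowI[of _ x])
      have ne: "b \<in> T \<inter> {x..}" using ab True by auto
      have d: "d \<in> T \<inter> {x..}"
        unfolding d_def using ne bdd T by (intro closed_contains_Inf closed_Int) auto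
      have db: "d \<le> b" unfolding d_def using ne bdd by (intro cInf_lower)
      have dl: "d \<le> t" if "t \<in> T" "x \<le> t" for t
        unfolding d_def using that bdd by (intro cInf_lower) auto
      have "{..<x} \<inter> W = {a..<d} \<inter> T"
        using d db dl True by (force simp: W_def)
      then show ?thesis using d db True ab unfolding E_def by force
    next
      case False
      then have "{..<x} \<inter> W = {} \<or> {..<x} \<inter> W = W" by (force simp: W_def)
      then show ?thesis using WE by (auto simp: E_def)
    qed
    have "sigma_sets UNIV (range (\<lambda>x::real. {..<x})) = sets borel"
      by (subst borel_eq_lessThan) (simp add: eucl_lessThan)
    then have "sets (restrict_space borel W) = (\<inter>) W ` sigma_sets UNIV (range (\<lambda>x::real. {..<x}))"
      by (simp add: sets_restrict_space)
    also have "\<dots> \<subseteq> sigma_sets W E"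
    proof safe
      fix X :: "real set" assume "X \<in> sigma_sets UNIV (range (\<lambda>x. {..<x}))"
      then show "W \<inter> X \<in> sigma_sets W E"
      proof induction
        case (Basic X)
        then show ?case using ray by (auto simp: Int_commute)
      next
        case Empty
        then show ?case by (simp add: sigma_sets.Empty)
      next
        case (Compl X)
        have "W \<inter> (UNIV - X) = W - W \<inter> X" by auto
        then show ?case using Compl sigma_sets.Compl by metis
      next
        case (Union X)
        have "W \<inter> (\<Union>i. X i) = (\<Union>i. W \<inter> X i)" by auto
        then show ?case using sigma_sets.Union[of "\<lambda>i. W \<inter> X i"] Union by simp
      qed
    qed
    finally show "sets (restrict_space borel W) \<subseteq> sigma_sets W E" .
  qed
  have st: "Int_stable E"
  proof (rule Int_stableI)
    fix X Y assume XY: "X \<in> E" "Y \<in> E"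
    show "X \<inter> Y \<in> E"
    proof (cases "X = {} \<or> Y = {}")
      case True
      then show ?thesis by (auto simp: E_def)
    next
      case False
      then obtain c d c' d' where *: "X = {c..<d} \<inter> T" "c \<in> T" "d \<in> T" "a \<le> c" "c < d" "d \<le> b"
        "Y = {c'..<d'} \<inter> T" "c' \<in> T" "d' \<in> T" "a \<le> c'" "c' < d'" "d' \<le> b"
        using XY unfolding E_def by auto
      have eq: "X \<inter> Y = {max c c'..<min d d'} \<inter> T" using * by auto
      show ?thesis
      proof (cases "max c c' < min d d'")
        case True
        moreover have "max c c' \<in> T" "min d d' \<in> T" using * by (auto simp: max_def min_def)
        moreover have "a \<le> max c c'" "min d d' \<le> b" using * by auto
        ultimately show ?thesis unfolding eq E_def by blast
      next
        case False
        then have "X \<inter> Y = {}" unfolding eq by auto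
        then show ?thesis by (simp add: E_def)
      qed
    qed
  qed
  show ?thesis
  proof (rule measure_eqI_generator_eq[OF st EW])
    show "sets M = sigma_sets W E" "sets N = sigma_sets W E"
      using M N gen by (auto simp: is_hilger_measure_def W_def)
    show "emeasure M X = emeasure N X" if "X \<in> E" for X
      using that M N by (auto simp: E_def is_hilger_measure_def)
    show "range (\<lambda>_::nat. W) \<subseteq> E" "(\<Union>i::nat. W) = W" using WE by auto
    show "emeasure M W \<noteq> \<infinity>"
      using M ab by (simp add: W_def is_hilger_measure_def)
  qed
qed

definition hilger_measure :: "real set \<Rightarrow> real \<Rightarrow> real \<Rightarrow> real measure" where
  "hilger_measure T a b = (THE M. is_hilger_measure T a b M)"

lemma is_hilger_measure_hilger_measure:
  assumes "closed T" "a \<in> T" "b \<in> T" "a < b"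
  shows "is_hilger_measure T a b (hilger_measure T a b)"
  unfolding hilger_measure_def
  using hilger_measure_exists[OF assms] hilger_measure_unique[OF assms] by (metis theI)

section \<open>The delta evolution graph\<close>

definition delta_integral ::
    "real set \<Rightarrow> real \<Rightarrow> real \<Rightarrow> real \<Rightarrow> (real \<Rightarrow> 'b::banach) \<Rightarrow> 'b" where
  "delta_integral T a b t z =
     strong_integral (hilger_measure T a b) (\<lambda>s. indicator ({a..<t} \<inter> T) s *\<^sub>R z s)"

definition evolution_graph ::
    "real set \<Rightarrow> real \<Rightarrow> real \<Rightarrow> real \<Rightarrow> real \<Rightarrow> ('b0::banach \<Rightarrow> 'b1::banach) \<Rightarrow>
     ((real \<Rightarrow> 'b0) set \<times> (real \<Rightarrow> 'b1) set) set" where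
  "evolution_graph T a b p0 p1 i01 =
     {(u, z). u \<in> Lp_space (hilger_measure T a b) p0 \<and> z \<in> Lp_space (hilger_measure T a b) p1 \<and>
        (\<exists>x U. (AE t in hilger_measure T a b. U t = i01 (class_rep u t)) \<and>
               (\<forall>t\<in>{a..b} \<inter> T. U t = x + delta_integral T a b t (class_rep z)))}"

definition evolution_norm ::
    "real set \<Rightarrow> real \<Rightarrow> real \<Rightarrow> real \<Rightarrow> real \<Rightarrow>
     (real \<Rightarrow> 'b0::banach) set \<times> (real \<Rightarrow> 'b1::banach) set \<Rightarrow> real" where
  "evolution_norm T a b p0 p1 =
     (\<lambda>(u, z). Lp_norm (hilger_measure T a b) p0 u + Lp_norm (hilger_measure T a b) p1 z)"

definition state_projection ::
    "real set \<Rightarrow> real \<Rightarrow> real \<Rightarrow> ('b0::banach \<Rightarrow> 'b::banach) \<Rightarrow>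
     (real \<Rightarrow> 'b0) set \<times> (real \<Rightarrow> 'b1::banach) set \<Rightarrow> (real \<Rightarrow> 'b) set" where
  "state_projection T a b i0B = (\<lambda>(u, z). ae_class (hilger_measure T a b) (i0B \<circ> class_rep u))"

end

theory Submission
  imports Defs
begin

text \<open>
  The result is an Aubin--Lions compactness theorem. The space \<open>L\<^sup>p(B)\<close> is complete
  (\<open>mcomplete_Lp\<close>), so it suffices to show that the states \<open>u\<close> of a bounded part of the evolution
  graph form a totally bounded set. Three facts combine.

  First, Ehrling's inequality \<open>\<parallel>x\<parallel>\<^bsub>B\<^esub> \<le> \<epsilon> \<parallel>x\<parallel>\<^bsub>B0\<^esub> + C \<parallel>x\<parallel>\<^bsub>B1\<^esub>\<close> (\<open>Ehrling_inequality\<close>) reduces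
  closeness in \<open>L\<^sup>p(B)\<close> to closeness in the weak space \<open>B1\<close>, because differences of states are
  bounded in \<open>L\<^sup>p(B0)\<close>.

  Secondly, the paths \<open>U(t) = x + \<integral> z\<close> over \<open>[a,t)\<close> are uniformly equicontinuous in \<open>B1\<close>,
  since the functions \<open>z\<close> are bounded in \<open>L\<^sup>q\<close> with \<open>q > 1\<close> and therefore uniformly integrable
  (\<open>bounded_trajectory_equicontinuous\<close>). Distances of times are measured in \<open>\<real>\<close>, so a jump
  across a long gap of the time scale may well be large.

  Thirdly, for each fixed \<open>t < b\<close> the values \<open>U(t)\<close> are totally bounded in \<open>B1\<close>
  (\<open>bounded_trajectory_values_finite_net\<close>). Right after \<open>t\<close> there is a set of times of positive measure
  on which \<open>U\<close> is almost constant: a short interval, or \<open>{t}\<close> itself when \<open>t\<close> is right-scattered. By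
  Chebyshev's inequality it contains a time \<open>s\<close> at which \<open>u(s)\<close> is bounded in \<open>B0\<close>, with a bound that
  is the same for all trajectories. Hence \<open>U(t)\<close> is close to the image of a fixed ball of \<open>B0\<close>, and
  that image is relatively compact.

  By equicontinuity a path is known up to a small error once its values on a finite \<open>\<delta>\<close>-net of times
  are, and these values can be sorted into finitely many classes. So a bounded set of trajectories
  splits into finitely many classes of uniformly \<open>B1\<close>-close paths
  (\<open>bounded_trajectories_finite_cover\<close>), whose states are then \<open>L\<^sup>p(B)\<close>-close.
\<close>

section \<open>Strong measurability and strong integrals\<close>

lemma strongly_measurable_cong_AE:
  assumes f: "strongly_measurable M f" and fg: "AE x in M. f x = g x"
  shows "strongly_measurable M g"
proof -
  obtain s where s: "\<And>i::nat. simple_function M (s i)"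
    and lim: "AE x in M. (\<lambda>i. s i x) \<longlonglongrightarrow> f x"
    using f unfolding strongly_measurable_def by blast
  have "AE x in M. (\<lambda>i. s i x) \<longlonglongrightarrow> g x"
    using lim fg by eventually_elim simp
  with s show ?thesis unfolding strongly_measurable_def by blast
qed

lemma strongly_measurable_bounded_linear:
  assumes f: "strongly_measurable M f" and h: "bounded_linear h"
  shows "strongly_measurable M (\<lambda>x. h (f x))"
proof -
  obtain s where s: "\<And>i::nat. simple_function M (s i)"
    and lim: "AE x in M. (\<lambda>i. s i x) \<longlonglongrightarrow> f x"
    using f unfolding strongly_measurable_def by blast
  have "AE x in M. (\<lambda>i. h (s i x)) \<longlonglongrightarrow> h (f x)"
    using lim by eventually_elim (rule bounded_linear.tendsto[OF h])
  moreover have "simple_function M (\<lambda>x. h (s i x))" for i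
    by (rule simple_function_compose1[OF s])
  ultimately show ?thesis
    unfolding strongly_measurable_def by (intro exI[of _ "\<lambda>i x. h (s i x)"]) blast
qed

lemma strongly_measurable_indicator:
  assumes f: "strongly_measurable M f" and A: "A \<in> sets M"
  shows "strongly_measurable M (\<lambda>x. indicator A x *\<^sub>R f x)"
proof -
  obtain s where s: "\<And>i::nat. simple_function M (s i)"
    and lim: "AE x in M. (\<lambda>i. s i x) \<longlonglongrightarrow> f x"
    using f unfolding strongly_measurable_def by blast
  have "AE x in M. (\<lambda>i. indicator A x *\<^sub>R s i x) \<longlonglongrightarrow> indicator A x *\<^sub>R f x"
    using lim by eventually_elim (intro tendsto_intros)
  moreover have "simple_function M (\<lambda>x. indicator A x *\<^sub>R s i x)" for i
    by (rule simple_function_compose2[OF simple_function_indicator[OF A] s])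
  ultimately show ?thesis
    unfolding strongly_measurable_def by (intro exI[of _ "\<lambda>i x. indicator A x *\<^sub>R s i x"]) blast
qed

lemma has_strong_integral_norm_le:
  assumes "has_strong_integral M f y"
  shows "ennreal (norm y) \<le> (\<integral>\<^sup>+x. norm (f x) \<partial>M)"
proof -
  obtain s where f: "strongly_measurable M f"
    and s: "\<And>i::nat. Bochner_Integration.simple_bochner_integrable M (s i)"
    "(\<lambda>i. \<integral>\<^sup>+x. norm (f x - s i x) \<partial>M) \<longlonglongrightarrow> 0"
    "(\<lambda>i. Bochner_Integration.simple_bochner_integral M (s i)) \<longlonglongrightarrow> y"
    using assms unfolding has_strong_integral_def by blast
  have 0: "Bochner_Integration.simple_bochner_integrable M (\<lambda>_. 0 :: 'b)"
    by (rule simple_bochner_integrableI_bounded) auto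
  have i0: "Bochner_Integration.simple_bochner_integral M (\<lambda>_. 0 :: 'b) = 0"
    unfolding simple_bochner_integral_def by (rule sum.neutral) auto
  have "ennreal (norm (Bochner_Integration.simple_bochner_integral M (s i))) \<le>
      (\<integral>\<^sup>+x. norm (f x - s i x) \<partial>M) + (\<integral>\<^sup>+x. norm (f x) \<partial>M)" for i
    using simple_bochner_integral_dist[OF f s(1)[of i] 0] by (simp add: i0)
  moreover have "(\<lambda>i. (\<integral>\<^sup>+x. norm (f x - s i x) \<partial>M) + (\<integral>\<^sup>+x. norm (f x) \<partial>M))
      \<longlonglongrightarrow> 0 + (\<integral>\<^sup>+x. norm (f x) \<partial>M)"
    by (intro tendsto_add s(2) tendsto_const)
  moreover have "(\<lambda>i. ennreal (norm (Bochner_Integration.simple_bochner_integral M (s i))))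
      \<longlonglongrightarrow> ennreal (norm y)"
    by (intro tendsto_ennrealI tendsto_norm s(3))
  ultimately show ?thesis
    using LIMSEQ_le by fastforce
qed

lemma has_strong_integral_diff:
  assumes "has_strong_integral M f y" "has_strong_integral M g z"
  shows "has_strong_integral M (\<lambda>x. f x - g x) (y - z)"
proof -
  obtain s where f: "strongly_measurable M f"
    and s: "\<And>i::nat. Bochner_Integration.simple_bochner_integrable M (s i)"
    "(\<lambda>i. \<integral>\<^sup>+x. norm (f x - s i x) \<partial>M) \<longlonglongrightarrow> 0"
    "(\<lambda>i. Bochner_Integration.simple_bochner_integral M (s i)) \<longlonglongrightarrow> y"
    using assms(1) unfolding has_strong_integral_def by blast
  obtain t where g: "strongly_measurable M g"
    and t: "\<And>i::nat. Bochner_Integration.simple_bochner_integrable M (t i)"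
    "(\<lambda>i. \<integral>\<^sup>+x. norm (g x - t i x) \<partial>M) \<longlonglongrightarrow> 0"
    "(\<lambda>i. Bochner_Integration.simple_bochner_integral M (t i)) \<longlonglongrightarrow> z"
    using assms(2) unfolding has_strong_integral_def by blast
  have sm: "strongly_measurable M (s i)" "strongly_measurable M (t i)" for i
    using s(1) t(1) by (auto intro: strongly_measurable_simple elim: simple_bochner_integrable.cases)
  have int: "Bochner_Integration.simple_bochner_integrable M (\<lambda>x. s i x - t i x)" for i
    using simple_bochner_integrable_compose2[of "(-)", OF _ s(1) t(1)] by simp
  have le: "(\<integral>\<^sup>+x. norm (f x - g x - (s i x - t i x)) \<partial>M) \<le>
      (\<integral>\<^sup>+x. norm (f x - s i x) \<partial>M) + (\<integral>\<^sup>+x. norm (g x - t i x) \<partial>M)" for i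
  proof -
    have "norm (f x - g x - (s i x - t i x)) \<le> norm (f x - s i x) + norm (g x - t i x)" for x
      using norm_triangle_ineq4[of "f x - s i x" "g x - t i x"] by (simp add: algebra_simps)
    then have "(\<integral>\<^sup>+x. norm (f x - g x - (s i x - t i x)) \<partial>M) \<le>
        (\<integral>\<^sup>+x. ennreal (norm (f x - s i x)) + ennreal (norm (g x - t i x)) \<partial>M)"
      by (intro nn_integral_mono) (metis ennreal_leI ennreal_plus norm_ge_zero)
    also have "\<dots> = (\<integral>\<^sup>+x. norm (f x - s i x) \<partial>M) + (\<integral>\<^sup>+x. norm (g x - t i x) \<partial>M)"
      by (intro nn_integral_norm_add strongly_measurable_diff f g sm)
    finally show ?thesis .
  qed
  have lim: "(\<lambda>i. (\<integral>\<^sup>+x. norm (f x - s i x) \<partial>M) + (\<integral>\<^sup>+x. norm (g x - t i x) \<partial>M)) \<longlonglongrightarrow> 0"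
    using tendsto_add[OF s(2) t(2)] by simp
  have "(\<lambda>i. \<integral>\<^sup>+x. norm (f x - g x - (s i x - t i x)) \<partial>M) \<longlonglongrightarrow> 0"
    by (rule tendsto_sandwich[OF _ always_eventually[OF allI[OF le]] tendsto_const lim]) simp
  moreover have "(\<lambda>i. Bochner_Integration.simple_bochner_integral M (\<lambda>x. s i x - t i x)) \<longlonglongrightarrow> y - z"
    using tendsto_diff[OF s(3) t(3)] by (simp add: simple_bochner_integral_diff[OF s(1) t(1)])
  ultimately show ?thesis
    unfolding has_strong_integral_def
    by (intro conjI strongly_measurable_diff f g exI[of _ "\<lambda>i x. s i x - t i x"]) (auto intro: int)
qed

text \<open>
  A bound on \<open>\<integral> r\<^sup>p\<close> controls \<open>\<integral> r\<close> over sets of small measure: the first term is small with the set, for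
  fixed \<open>K\<close>, and the coefficient of the second one tends to \<open>0\<close> as \<open>K\<close> grows if \<open>p > 1\<close>. This form of
  uniform integrability takes the place of Hoelder's inequality.
\<close>

lemma norm_le_add_powr:
  fixes r K p :: real
  assumes "0 \<le> r" "0 < K" "1 \<le> p"
  shows "r \<le> K + K powr (1 - p) * r powr p"
proof (cases "r \<le> K")
  case True
  then show ?thesis by (simp add: add_increasing2)
next
  case False
  then have r: "K < r" "0 < r" using assms by auto
  have "r = r powr (1 - p) * r powr p"
    using r by (simp flip: powr_add)
  also have "\<dots> \<le> K powr (1 - p) * r powr p"
    using r assms by (intro mult_right_mono powr_mono2') auto
  finally show ?thesis using assms by simp
qed

lemma nn_integral_norm_le_p_integral:
  assumes f: "strongly_measurable M f" and A: "A \<in> sets M" and K: "0 < K" and p: "1 \<le> p"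
  shows "(\<integral>\<^sup>+x. norm (indicator A x *\<^sub>R f x) \<partial>M) \<le>
    ennreal K * emeasure M A + ennreal (K powr (1 - p)) * p_integral M p f"
proof -
  obtain g where g[measurable]: "g \<in> borel_measurable M" and g0: "\<And>x. 0 \<le> g x"
    and fg: "AE x in M. norm (f x) powr p = (g x :: real)"
    using strongly_measurable_powr[OF f] by metis
  note [measurable] = A
  have "(\<integral>\<^sup>+x. norm (indicator A x *\<^sub>R f x) \<partial>M) \<le>
      (\<integral>\<^sup>+x. ennreal K * indicator A x + ennreal (K powr (1 - p)) * ennreal (g x) \<partial>M)"
  proof (rule nn_integral_mono_AE, use fg in eventually_elim)
    case (elim x)
    show ?case
      using norm_le_add_powr[of "norm (f x)" K p] K p g0[of x] elim
      by (auto simp: indicator_def simp flip: ennreal_mult ennreal_plus)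
  qed
  also have "\<dots> = ennreal K * emeasure M A + ennreal (K powr (1 - p)) * (\<integral>\<^sup>+x. g x \<partial>M)"
    by (simp add: nn_integral_add nn_integral_cmult)
  also have "(\<integral>\<^sup>+x. g x \<partial>M) = p_integral M p f"
    unfolding p_integral_def by (rule nn_integral_cong_AE) (use fg in \<open>eventually_elim, simp\<close>)
  finally show ?thesis .
qed

section \<open>Completeness of Bochner spaces\<close>

text \<open>Fatou's lemma. Closed balls of \<open>L\<^sup>p\<close> are closed under limits almost everywhere.\<close>

lemma p_integral_ae_limit_le:
  assumes m: "\<And>j::nat. (\<lambda>x. norm (h j x)) \<in> borel_measurable M"
    and lim: "AE x in M. (\<lambda>j. h j x) \<longlonglongrightarrow> f x"
    and le: "\<And>j. j \<ge> k \<Longrightarrow> p_integral M p (h j) \<le> C"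
    and p: "0 < p"
  shows "p_integral M p f \<le> C"
proof -
  have [measurable]: "(\<lambda>x. ennreal (norm (h j x) powr p)) \<in> borel_measurable M" for j
    using m[of j] by measurable
  have "p_integral M p f = (\<integral>\<^sup>+x. liminf (\<lambda>j. ennreal (norm (h j x) powr p)) \<partial>M)"
    unfolding p_integral_def
  proof (rule nn_integral_cong_AE, use lim in eventually_elim)
    case (elim x)
    then have "(\<lambda>j. ennreal (norm (h j x) powr p)) \<longlonglongrightarrow> ennreal (norm (f x) powr p)"
      using p by (intro tendsto_ennrealI tendsto_powr' tendsto_norm tendsto_const) auto
    then show ?case by (intro lim_imp_Liminf[symmetric]) auto
  qed
  also have "\<dots> \<le> liminf (\<lambda>j. p_integral M p (h j))"
    unfolding p_integral_def by (rule nn_integral_liminf) measurable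
  also have "\<dots> \<le> C"
    by (rule Liminf_le) (use le in \<open>auto simp: eventually_sequentially\<close>)
  finally show ?thesis .
qed

lemma simple_functions_dense_Lp:
  assumes f: "strongly_measurable M f" and fin: "p_integral M p f < \<infinity>" and p: "1 \<le> p"
    and e: "0 < (e::ennreal)"
  obtains s where "simple_function M s" "p_integral M p s < \<infinity>" "p_integral M p (\<lambda>x. f x - s x) < e"
proof -
  obtain s where s: "\<And>i::nat. simple_function M (s i)"
    and lim: "AE x in M. (\<lambda>i. s i x) \<longlonglongrightarrow> f x"
    using f unfolding strongly_measurable_def by blast
  obtain g where g[measurable]: "g \<in> borel_measurable M" and g0: "\<And>x. 0 \<le> g x"
    and fg: "AE x in M. norm (f x) = (g x :: real)"
    using strongly_measurable_norm[OF f] by metis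
  have gfin: "(\<integral>\<^sup>+x. ennreal (g x powr p) \<partial>M) < \<infinity>"
  proof -
    have "p_integral M p f = (\<integral>\<^sup>+x. ennreal (g x powr p) \<partial>M)"
      unfolding p_integral_def by (rule nn_integral_cong_AE) (use fg in \<open>eventually_elim, simp\<close>)
    then show ?thesis using fin by simp
  qed
  have dom_fin: "(\<integral>\<^sup>+x. ennreal ((c * g x) powr p) \<partial>M) < \<infinity>" if "0 \<le> c" for c
  proof -
    have "(\<integral>\<^sup>+x. ennreal ((c * g x) powr p) \<partial>M) = (\<integral>\<^sup>+x. ennreal (c powr p) * ennreal (g x powr p) \<partial>M)"
      using that g0 by (intro nn_integral_cong) (simp add: powr_mult ennreal_mult)
    also have "\<dots> = ennreal (c powr p) * (\<integral>\<^sup>+x. ennreal (g x powr p) \<partial>M)"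
      by (intro nn_integral_cmult) measurable
    finally show ?thesis using gfin by (simp add: ennreal_mult_less_top)
  qed
  have ns[measurable]: "(\<lambda>x. norm (s i x)) \<in> borel_measurable M" for i
    by (rule borel_measurable_simple_function) (rule simple_function_compose1[OF s])
  \<comment> \<open>Cutting \<open>s i\<close> off where it exceeds \<open>2 |f|\<close> keeps the pointwise limit and provides a majorant.\<close>
  define A where "A i = {x\<in>space M. norm (s i x) \<le> 2 * g x}" for i
  have A[measurable]: "A i \<in> sets M" for i unfolding A_def by measurable
  define t where "t i x = indicator (A i) x *\<^sub>R s i x" for i x
  have simp_t: "simple_function M (t i)" for i
    unfolding t_def by (rule simple_function_compose2[OF simple_function_indicator[OF A] s])
  have bt: "norm (t i x) \<le> 2 * g x" for i x
    using g0[of x] by (auto simp: t_def A_def indicator_def)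
  have tfin: "p_integral M p (t i) < \<infinity>" for i
  proof -
    have "p_integral M p (t i) \<le> (\<integral>\<^sup>+x. ennreal ((2 * g x) powr p) \<partial>M)"
      unfolding p_integral_def using bt p by (intro nn_integral_mono ennreal_leI powr_mono2) auto
    then show ?thesis using dom_fin[of 2] by auto
  qed
  have limt: "AE x in M. (\<lambda>i. t i x) \<longlonglongrightarrow> f x"
    using lim fg AE_space
  proof eventually_elim
    case (elim x)
    show ?case
    proof (cases "f x = 0")
      case True
      then have "t i x = 0" for i
        using elim by (auto simp: t_def A_def indicator_def)
      then show ?thesis using True by simp
    next
      case False
      then have "norm (f x) < 2 * g x" using elim(2) by (metis zero_less_norm_iff mult_2 less_add_same_cancel1)
      then have "\<forall>\<^sub>F i in sequentially. norm (s i x) < 2 * g x"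
        by (rule order_tendstoD(2)[OF tendsto_norm[OF elim(1)]])
      then have "\<forall>\<^sub>F i in sequentially. s i x = t i x"
        using elim(3) by (auto elim!: eventually_mono simp: t_def A_def)
      with elim(1) show ?thesis by (rule Lim_transform_eventually)
    qed
  qed
  have "\<exists>h. h \<in> borel_measurable M \<and> (\<forall>x. 0 \<le> h x) \<and> (AE x in M. norm (f x - t i x) = (h x :: real))" for i
    using strongly_measurable_norm[OF strongly_measurable_diff[OF f strongly_measurable_simple[OF simp_t]]]
    by metis
  then obtain h where h[measurable]: "\<And>i. h i \<in> borel_measurable M" and h0: "\<And>i x. 0 \<le> h i x"
    and fh: "\<And>i. AE x in M. norm (f x - t i x) = (h i x :: real)"
    by metis
  have fh': "AE x in M. \<forall>i. norm (f x - t i x) = h i x"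
    using fh by (simp add: AE_all_countable)
  have "(\<lambda>i. \<integral>\<^sup>+x. ennreal (h i x powr p) \<partial>M) \<longlonglongrightarrow> (\<integral>\<^sup>+x. 0 \<partial>M)"
  proof (rule nn_integral_dominated_convergence[where w = "\<lambda>x. ennreal ((3 * g x) powr p)"])
    show "AE x in M. ennreal (h j x powr p) \<le> ennreal ((3 * g x) powr p)" for j
      using fh[of j] fg
    proof eventually_elim
      case (elim x)
      have "norm (f x - t j x) \<le> norm (f x) + norm (t j x)" by (rule norm_triangle_ineq4)
      then have "h j x \<le> 3 * g x" using bt[of j x] elim by simp
      then show ?case using h0[of j x] p by (intro ennreal_leI powr_mono2) auto
    qed
    show "(\<integral>\<^sup>+x. ennreal ((3 * g x) powr p) \<partial>M) < \<infinity>" using dom_fin[of 3] by simp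
    show "AE x in M. (\<lambda>i. ennreal (h i x powr p)) \<longlonglongrightarrow> 0"
      using fh' limt
    proof eventually_elim
      case (elim x)
      have "(\<lambda>i. norm (f x - t i x)) \<longlonglongrightarrow> norm (f x - f x)"
        by (intro tendsto_intros elim)
      then have "(\<lambda>i. h i x) \<longlonglongrightarrow> 0" using elim(1) by simp
      then have "(\<lambda>i. h i x powr p) \<longlonglongrightarrow> 0 powr p"
        using p h0 by (intro tendsto_powr') auto
      then have "(\<lambda>i. ennreal (h i x powr p)) \<longlonglongrightarrow> ennreal (0 powr p)" by (rule tendsto_ennrealI)
      then show ?case using p by simp
    qed
  qed measurable
  moreover have "p_integral M p (\<lambda>x. f x - t i x) = (\<integral>\<^sup>+x. ennreal (h i x powr p) \<partial>M)" for i
    unfolding p_integral_def by (rule nn_integral_cong_AE) (use fh[of i] in \<open>eventually_elim, simp\<close>)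
  ultimately have "(\<lambda>i. p_integral M p (\<lambda>x. f x - t i x)) \<longlonglongrightarrow> 0" by simp
  then have "\<forall>\<^sub>F i in sequentially. p_integral M p (\<lambda>x. f x - t i x) < e"
    using e by (rule order_tendstoD)
  then obtain i where "p_integral M p (\<lambda>x. f x - t i x) < e"
    by (auto simp: eventually_sequentially)
  then show ?thesis using that simp_t tfin by blast
qed

lemma p_norm_nonneg: "0 \<le> p_norm M p f"
  by (simp add: p_norm_def)

lemma p_integral_le_powr_iff:
  assumes "1 \<le> p" "p_integral M p f < \<infinity>" "0 \<le> C"
  shows "p_integral M p f \<le> ennreal (C powr p) \<longleftrightarrow> p_norm M p f \<le> C"
proof -
  have "p_norm M p f powr p \<le> C powr p \<longleftrightarrow> p_norm M p f \<le> C"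
  proof (cases "p_norm M p f \<le> C")
    case True
    then show ?thesis using assms p_norm_nonneg[of M p f] by (simp add: powr_mono2)
  next
    case False
    then have "C powr p < p_norm M p f powr p" using assms by (intro powr_less_mono2) auto
    then show ?thesis using False by simp
  qed
  then show ?thesis
    unfolding p_norm_powr[OF assms(1,2)] by simp
qed

text \<open>
  The ratio \<open>1/4\<close> beats the thresholds \<open>(1/2)^k\<close> in Markov's inequality, so that the sets where
  consecutive functions differ by \<open>(1/2)^k\<close> or more have summable measure and the Borel--Cantelli
  lemma applies. Outside a null set the increments are eventually dominated by a geometric series.
\<close>

lemma Lp_rapidly_Cauchy_AE_convergent:
  fixes s :: "nat \<Rightarrow> 'a \<Rightarrow> 'b::banach"
  assumes s: "\<And>k. simple_function M (s k)" and p: "1 \<le> p"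
    and fast: "\<And>k. p_integral M p (\<lambda>x. s (Suc k) x - s k x) \<le> ennreal (((1/4)^k) powr p)"
  obtains f where "AE x in M. (\<lambda>k. s k x) \<longlonglongrightarrow> f x"
proof -
  define A where "A k = {x\<in>space M. (1/2)^k \<le> norm (s (Suc k) x - s k x)}" for k
  have m[measurable]: "(\<lambda>x. norm (s (Suc k) x - s k x)) \<in> borel_measurable M" for k
    by (rule borel_measurable_simple_function)
      (rule simple_function_compose1[OF simple_function_compose2[OF s s]])
  have A[measurable]: "A k \<in> sets M" for k unfolding A_def by measurable
  have AM: "emeasure M (A k) \<le> ennreal ((1/2)^k)" for k
  proof -
    have "ennreal (((1/2)^k) powr p) * emeasure M (A k) = (\<integral>\<^sup>+x. ennreal (((1/2)^k) powr p) * indicator (A k) x \<partial>M)"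
      by (simp add: nn_integral_cmult)
    also have "\<dots> \<le> p_integral M p (\<lambda>x. s (Suc k) x - s k x)"
      unfolding p_integral_def using p
      by (intro nn_integral_mono) (auto simp: A_def indicator_def intro!: ennreal_leI powr_mono2)
    also have "\<dots> \<le> ennreal (((1/4)^k) powr p)" by (rule fast)
    finally have *: "ennreal (((1/2)^k) powr p) * emeasure M (A k) \<le> ennreal (((1/4)^k) powr p)" .
    have "emeasure M (A k) = ennreal (((1/2)^k) powr (- p)) * (ennreal (((1/2)^k) powr p) * emeasure M (A k))"
      by (simp flip: mult.assoc ennreal_mult powr_add)
    also have "\<dots> \<le> ennreal (((1/2)^k) powr (- p)) * ennreal (((1/4)^k) powr p)"
      by (intro mult_left_mono *) auto
    also have "\<dots> = ennreal (((1/2)^k) powr p)"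
    proof -
      have "((1/4::real)^k) = (1/2)^k * (1/2)^k" by (simp flip: power_mult_distrib)
      then show ?thesis by (simp add: powr_mult powr_minus flip: ennreal_mult)
    qed
    also have "\<dots> \<le> ennreal (((1/2)^k) powr 1)"
      using p by (intro ennreal_leI powr_mono') (auto simp: power_le_one)
    finally show ?thesis by simp
  qed
  have "AE x in M. eventually (\<lambda>k. x \<in> space M - A k) sequentially"
  proof (rule borel_cantelli_AE1[OF A])
    show "emeasure M (A k) < \<infinity>" for k
      using AM[of k] by (auto intro: le_less_trans)
    have "measure M (A k) \<le> (1/2)^k" for k
      unfolding measure_def by (rule enn2real_leI[OF _ AM]) simp
    then show "summable (\<lambda>k. measure M (A k))"
      by (intro summable_comparison_test'[OF summable_geometric[of "1/2::real"], of 0]) auto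
  qed
  then have "AE x in M. (\<lambda>k. s k x) \<longlonglongrightarrow> lim (\<lambda>k. s k x)"
  proof eventually_elim
    case (elim x)
    then obtain N where N: "\<And>k. k \<ge> N \<Longrightarrow> norm (s (Suc k) x - s k x) \<le> (1/2)^k"
      by (force simp: A_def eventually_sequentially)
    have "summable (\<lambda>k. s (Suc k) x - s k x)"
      by (rule summable_comparison_test'[OF summable_geometric[of "1/2::real"], of N]) (use N in auto)
    then have "convergent (\<lambda>n. \<Sum>k<n. s (Suc k) x - s k x)"
      by (simp add: summable_iff_convergent)
    then have "convergent (\<lambda>n. s n x - s 0 x)"
      by (simp only: sum_lessThan_telescope[of "\<lambda>k. s k x"])
    then have "convergent (\<lambda>n. s n x)"
      by (simp add: convergent_diff_const_right_iff)
    then show ?case by (simp add: convergent_LIMSEQ_iff)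
  qed
  then show ?thesis by (rule that)
qed

text \<open>
  A rapidly Cauchy subsequence is replaced by simple functions that approximate it ever better. These
  converge almost everywhere, and their limit is strongly measurable by the very definition; passing
  through simple functions thus avoids showing that strong measurability survives pointwise limits.
\<close>

lemma mcomplete_Lp:
  assumes p: "1 \<le> p"
  shows "Metric_space.mcomplete (Lp_space M p) (Lp_dist M p :: ('a \<Rightarrow> 'b::banach) set \<Rightarrow> _)"
proof -
  interpret Lp: Metric_space "Lp_space M p" "Lp_dist M p :: ('a \<Rightarrow> 'b) set \<Rightarrow> _"
    by (rule Metric_space_Lp[OF p])
  show ?thesis
    unfolding Lp.mcomplete_def
  proof (intro allI impI)
    fix F :: "nat \<Rightarrow> ('a \<Rightarrow> 'b) set"
    assume F: "Lp.MCauchy F"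
    have Fin: "F n \<in> Lp_space M p" for n using F by (auto simp: Lp.MCauchy_def)
    have ex: "\<exists>N. \<forall>m\<ge>N. \<forall>n\<ge>N. Lp_dist M p (F m) (F n) < (1/4)^k / 3" for k
    proof -
      have "0 < ((1/4)^k / 3 :: real)" by simp
      with F show ?thesis unfolding Lp.MCauchy_def by metis
    qed
    \<comment> \<open>With the factor \<open>1/3\<close> the three-term estimate below yields exactly \<open>(1/4)^k\<close>.\<close>
    have "\<exists>r. \<forall>k. (\<forall>m\<ge>r k. \<forall>n\<ge>r k. Lp_dist M p (F m) (F n) < (1/4)^k / 3) \<and> r k < r (Suc k)"
    proof (rule dependent_nat_choice)
      show "\<exists>x. \<forall>m\<ge>x. \<forall>n\<ge>x. Lp_dist M p (F m) (F n) < (1/4)^0 / 3" by (rule ex)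
      fix x k
      obtain N where N: "\<forall>m\<ge>N. \<forall>n\<ge>N. Lp_dist M p (F m) (F n) < (1/4)^(Suc k) / 3" using ex by blast
      show "\<exists>y. (\<forall>m\<ge>y. \<forall>n\<ge>y. Lp_dist M p (F m) (F n) < (1/4)^(Suc k) / 3) \<and> x < y"
        by (rule exI[of _ "max N (Suc x)"]) (use N in auto)
    qed
    then obtain r where r: "\<And>k m n. r k \<le> m \<Longrightarrow> r k \<le> n \<Longrightarrow> Lp_dist M p (F m) (F n) < (1/4)^k / 3"
      and r_mono: "strict_mono r"
      by (metis strict_mono_Suc_iff)
    have "\<exists>s. simple_function M s \<and> p_integral M p s < \<infinity> \<and> Lp_dist M p (F (r k)) (ae_class M s) \<le> (1/4)^k / 3" for k
    proof -
      obtain f where f: "F (r k) = ae_class M f" "strongly_measurable M f" "p_integral M p f < \<infinity>"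
        using Fin[of "r k"] unfolding Lp_space_def by blast
      have "0 < ennreal (((1/4)^k / 3) powr p)" by simp
      from simple_functions_dense_Lp[OF f(2,3) p this]
      obtain s where s: "simple_function M s" "p_integral M p s < \<infinity>"
        "p_integral M p (\<lambda>x. f x - s x) < ennreal (((1/4)^k / 3) powr p)" by blast
      then have "p_norm M p (\<lambda>x. f x - s x) \<le> (1/4)^k / 3"
        by (subst p_integral_le_powr_iff[symmetric, OF p]) (auto intro: less_trans)
      with s show ?thesis by (auto simp: f(1) Lp_dist_ae_class)
    qed
    then obtain s where s: "\<And>k. simple_function M (s k)" and sfin: "\<And>k. p_integral M p (s k) < \<infinity>"
      and Fs: "\<And>k. Lp_dist M p (F (r k)) (ae_class M (s k)) \<le> (1/4)^k / 3"
      by metis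
    have sL: "ae_class M (s k) \<in> Lp_space M p" for k
      unfolding Lp_space_def using s sfin strongly_measurable_simple by blast
    have d: "Lp_dist M p (ae_class M (s j)) (ae_class M (s k)) \<le> (1/4)^k" if "k \<le> j" for j k
    proof -
      have "(1/4::real)^j \<le> (1/4)^k" using that by (intro power_decreasing) auto
      moreover have "Lp_dist M p (F (r j)) (F (r k)) < (1/4)^k / 3"
        using r_mono that by (intro r) (auto simp: strict_mono_less_eq)
      moreover have "Lp_dist M p (ae_class M (s j)) (ae_class M (s k)) \<le>
          Lp_dist M p (ae_class M (s j)) (F (r j)) + (Lp_dist M p (F (r j)) (F (r k)) + Lp_dist M p (F (r k)) (ae_class M (s k)))"
        using Lp.triangle[OF sL Fin sL] Lp.triangle[OF Fin Fin sL] by (meson add_left_mono order_trans)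
      ultimately show ?thesis
        using Fs[of j] Fs[of k] Lp.commute[of "ae_class M (s j)" "F (r j)"] by linarith
    qed
    have dint: "p_integral M p (\<lambda>x. s j x - s k x) \<le> ennreal (((1/4)^k) powr p)" if "k \<le> j" for j k
    proof (subst p_integral_le_powr_iff[OF p])
      show "p_integral M p (\<lambda>x. s j x - s k x) < \<infinity>"
        by (intro Lp_diff(2) strongly_measurable_simple s sfin p)
    qed (use d[OF that] in \<open>auto simp: Lp_dist_ae_class\<close>)
    obtain f where f: "AE x in M. (\<lambda>k. s k x) \<longlonglongrightarrow> f x"
      using Lp_rapidly_Cauchy_AE_convergent[OF s p dint] by auto
    have sf: "strongly_measurable M f"
      unfolding strongly_measurable_def using s f by blast
    have fs: "p_integral M p (\<lambda>x. s k x - f x) \<le> ennreal (((1/4)^k) powr p)" for k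
    proof (rule p_integral_ae_limit_le)
      show "(\<lambda>x. norm (s k x - s j x)) \<in> borel_measurable M" for j
        by (rule borel_measurable_simple_function)
          (rule simple_function_compose1[OF simple_function_compose2[OF s s]])
      show "AE x in M. (\<lambda>j. s k x - s j x) \<longlonglongrightarrow> s k x - f x"
        using f by eventually_elim (intro tendsto_intros)
      show "p_integral M p (\<lambda>x. s k x - s j x) \<le> ennreal (((1/4)^k) powr p)" if "k \<le> j" for j
        using dint[OF that] by (simp add: p_integral_def norm_minus_commute)
    qed (use p in auto)
    have fsfin: "p_integral M p (\<lambda>x. s k x - f x) < \<infinity>" for k
      using fs[of k] by (auto intro: le_less_trans)
    have "p_integral M p f < \<infinity>"
    proof (rule p_norm_add_le(1)[OF strongly_measurable_simple[OF s]
          strongly_measurable_diff[OF strongly_measurable_simple[OF s] sf] p sfin fsfin])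
      show "AE x in M. norm (f x) \<le> norm (s 0 x) + norm (s 0 x - f x)"
      proof (rule AE_I2)
        show "norm (f x) \<le> norm (s 0 x) + norm (s 0 x - f x)" for x
          using norm_triangle_ineq4[of "s 0 x" "s 0 x - f x"] by simp
      qed
    qed
    with sf have fL: "ae_class M f \<in> Lp_space M p" unfolding Lp_space_def by blast
    have lim: "Lp_dist M p (F (r k)) (ae_class M f) \<le> 2 * (1/4)^k" for k
    proof -
      have "Lp_dist M p (ae_class M (s k)) (ae_class M f) \<le> (1/4)^k"
        using fs[of k] fsfin p by (simp add: Lp_dist_ae_class p_integral_le_powr_iff)
      moreover have "(0::real) \<le> (1/4)^k" by simp
      ultimately show ?thesis using Lp.triangle[OF Fin sL fL, of "r k" k] Fs[of k] by linarith
    qed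
    have "(\<lambda>k. Lp_dist M p (F (r k)) (ae_class M f)) \<longlonglongrightarrow> 0"
    proof (rule tendsto_sandwich[OF _ _ tendsto_const])
      show "(\<lambda>k. 2 * (1/4::real)^k) \<longlonglongrightarrow> 0"
        using tendsto_mult_right_zero[OF LIMSEQ_power_zero[of "1/4::real"]] by simp
    qed (use lim in auto)
    then have "limitin Lp.mtopology (F \<circ> r) (ae_class M f) sequentially"
      using fL Fin by (simp add: Lp.limitin_metric_dist_null)
    then show "\<exists>G. limitin Lp.mtopology F G sequentially"
      using Lp.MCauchy_convergent_subsequence[OF F r_mono] by blast
  qed
qed


lemma p_norm_scaleR:
  assumes f: "strongly_measurable M f" and p: "1 \<le> p" and fin: "p_integral M p f < \<infinity>" and c: "0 \<le> c"
  shows "p_integral M p (\<lambda>x. c *\<^sub>R f x) < \<infinity>" "p_norm M p (\<lambda>x. c *\<^sub>R f x) = c * p_norm M p f"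
proof -
  obtain g where g[measurable]: "g \<in> borel_measurable M" and g0: "\<And>x. 0 \<le> g x"
    and fg: "AE x in M. norm (f x) powr p = (g x :: real)"
    using strongly_measurable_powr[OF f] by metis
  have "p_integral M p (\<lambda>x. c *\<^sub>R f x) = (\<integral>\<^sup>+x. ennreal (c powr p) * ennreal (g x) \<partial>M)"
    unfolding p_integral_def
  proof (rule nn_integral_cong_AE, use fg in eventually_elim)
    case (elim x)
    then show ?case using c g0[of x] by (simp add: powr_mult ennreal_mult)
  qed
  also have "\<dots> = ennreal (c powr p) * (\<integral>\<^sup>+x. g x \<partial>M)"
    by (intro nn_integral_cmult) measurable
  also have "(\<integral>\<^sup>+x. g x \<partial>M) = p_integral M p f"
    unfolding p_integral_def by (rule nn_integral_cong_AE) (use fg in \<open>eventually_elim, simp\<close>)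
  finally have *: "p_integral M p (\<lambda>x. c *\<^sub>R f x) = ennreal (c powr p) * p_integral M p f" .
  then show "p_integral M p (\<lambda>x. c *\<^sub>R f x) < \<infinity>"
    using fin by (simp add: ennreal_mult_less_top)
  show "p_norm M p (\<lambda>x. c *\<^sub>R f x) = c * p_norm M p f"
    unfolding p_norm_def * using c p by (simp add: enn2real_mult powr_mult powr_powr)
qed

lemma p_norm_const:
  assumes "finite_measure M" "1 \<le> p" "0 \<le> c"
  shows "p_integral M p (\<lambda>_. c::real) < \<infinity>"
    "p_norm M p (\<lambda>_. c) = c * measure M (space M) powr (1 / p)"
proof -
  interpret finite_measure M by fact
  have *: "p_integral M p (\<lambda>_. c) = ennreal (c powr p) * emeasure M (space M)"
    using assms by (simp add: p_integral_def)
  show "p_integral M p (\<lambda>_. c) < \<infinity>"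
    unfolding * by (simp add: ennreal_mult_less_top emeasure_eq_measure)
  show "p_norm M p (\<lambda>_. c) = c * measure M (space M) powr (1 / p)"
    unfolding p_norm_def * using assms by (simp add: enn2real_mult powr_mult powr_powr measure_def)
qed

text \<open>
  This turns a pointwise Ehrling inequality, with its second term bounded uniformly in time, into an
  inequality between norms in \<open>L\<^sup>p\<close>.
\<close>

lemma p_norm_le_affine:
  assumes M: "finite_measure M" and f: "strongly_measurable M f" and p: "1 \<le> p"
    and fin: "p_integral M p f < \<infinity>" and e: "0 \<le> e" and c: "0 \<le> c"
    and le: "AE x in M. norm (h x) \<le> e * norm (f x) + c"
  shows "p_integral M p h < \<infinity>" "p_norm M p h \<le> e * p_norm M p f + c * measure M (space M) powr (1 / p)"
proof -
  have ef: "strongly_measurable M (\<lambda>x. e *\<^sub>R f x)"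
    by (rule strongly_measurable_bounded_linear[OF f]) (rule bounded_linear_scaleR_right)
  have cm: "strongly_measurable M (\<lambda>_. c)"
    by (rule strongly_measurable_simple) simp
  have "AE x in M. norm (h x) \<le> norm (e *\<^sub>R f x) + norm c"
    using le e c by simp
  note add = p_norm_add_le[OF ef cm p p_norm_scaleR(1)[OF f p fin e] p_norm_const(1)[OF M p c] this]
  show "p_integral M p h < \<infinity>" by (rule add(1))
  show "p_norm M p h \<le> e * p_norm M p f + c * measure M (space M) powr (1 / p)"
    using add(2) unfolding p_norm_scaleR(2)[OF f p fin e] p_norm_const(2)[OF M p c] .
qed

lemma Lp_space_class_rep:
  assumes "F \<in> Lp_space M p"
  shows "strongly_measurable M (class_rep F)" "p_integral M p (class_rep F) < \<infinity>"
proof -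
  obtain f where f: "F = ae_class M f" "strongly_measurable M f" "p_integral M p f < \<infinity>"
    using assms unfolding Lp_space_def by blast
  have eq: "AE x in M. class_rep F x = f x" unfolding f(1) by (rule class_rep_AE)
  have eq': "AE x in M. f x = class_rep F x" using eq by eventually_elim simp
  show "strongly_measurable M (class_rep F)"
    by (rule strongly_measurable_cong_AE[OF f(2) eq'])
  have "p_integral M p (class_rep F) = p_integral M p f"
    unfolding p_integral_def by (rule nn_integral_cong_AE) (use eq in \<open>eventually_elim, simp\<close>)
  then show "p_integral M p (class_rep F) < \<infinity>" using f by simp
qed

section \<open>Compact embeddings\<close>

lemma compact_closure_image_cball:
  assumes "compact_map UNIV norm euclidean i"
  shows "compact (closure (i ` cball 0 R))"
proof -
  have "\<exists>C. \<forall>x\<in>cball 0 R. norm x \<le> C" by (intro exI[of _ R]) simp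
  then have "compactin euclidean (euclidean closure_of (i ` cball 0 R))"
    using assms unfolding compact_map_def by blast
  then show ?thesis by simp
qed

text \<open>
  On the compact set of points in the closure of \<open>i (unit ball)\<close> that have norm at least \<open>e\<close>, the
  continuous function \<open>\<parallel>j w\<parallel>\<close> has no zero, by injectivity, and so it has a positive minimum \<open>m\<close>. For a
  unit vector, either \<open>\<parallel>i x\<parallel> < e\<close>, or \<open>\<parallel>j (i x)\<parallel> \<ge> m\<close> and a multiple of it dominates the operator bound
  of \<open>i\<close>. The general case follows by homogeneity.
\<close>

lemma Ehrling_inequality:
  fixes i :: "'a::real_normed_vector \<Rightarrow> 'b::real_normed_vector" and j :: "'b \<Rightarrow> 'c::real_normed_vector"
  assumes i: "bounded_linear i" and comp: "compact_map UNIV norm euclidean i"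
    and j: "bounded_linear j" "inj j" and e: "0 < e"
  obtains C where "0 < C" "\<And>x. norm (i x) \<le> e * norm x + C * norm (j (i x))"
proof -
  define K where "K = closure (i ` cball 0 1) \<inter> {w. e \<le> norm w}"
  have K: "compact K"
    unfolding K_def
    by (intro compact_Int_closed compact_closure_image_cball comp closed_Collect_le continuous_intros)
  obtain B where B: "0 < B" "\<And>x. norm (i x) \<le> norm x * B"
    using bounded_linear.pos_bounded[OF i] by blast
  have "\<exists>m>0. \<forall>w\<in>K. m \<le> norm (j w)"
  proof (cases "K = {}")
    case True
    then show ?thesis by (auto intro: exI[of _ 1])
  next
    case False
    have "continuous_on K (\<lambda>w. norm (j w))"
      using j(1) by (intro continuous_intros linear_continuous_on)
    then obtain w where w: "w \<in> K" "\<And>v. v \<in> K \<Longrightarrow> norm (j w) \<le> norm (j v)"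
      using continuous_attains_inf[OF K False] by blast
    have "w \<noteq> 0" using w(1) e by (auto simp: K_def)
    then have "j w \<noteq> 0"
      using j by (metis injD linear_simps(3))
    then show ?thesis using w by (intro exI[of _ "norm (j w)"]) auto
  qed
  then obtain m where m: "0 < m" "\<And>w. w \<in> K \<Longrightarrow> m \<le> norm (j w)" by blast
  have unit: "norm (i y) \<le> e + B / m * norm (j (i y))" if "norm y = 1" for y
  proof (cases "e \<le> norm (i y)")
    case True
    then have "i y \<in> K" unfolding K_def using that closure_subset by fastforce
    then have "B \<le> B / m * norm (j (i y))" using m B by (simp add: field_simps)
    then show ?thesis using B(2)[of y] that e by simp
  next
    case False
    then show ?thesis using B m by (simp add: add_increasing2)
  qed
  have "norm (i x) \<le> e * norm x + B / m * norm (j (i x))" for x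
  proof (cases "x = 0")
    case True
    then show ?thesis using i j B m by (simp add: linear_simps(3))
  next
    case False
    have "norm (i x) = norm x * norm (i (x /\<^sub>R norm x))"
      using False by (simp add: linear_simps(5)[OF i])
    also have "\<dots> \<le> norm x * (e + B / m * norm (j (i (x /\<^sub>R norm x))))"
      using False by (intro mult_left_mono unit) auto
    also have "\<dots> = e * norm x + B / m * norm (j (i x))"
      using False by (simp add: linear_simps(5)[OF i] linear_simps(5)[OF j(1)] field_simps)
    finally show ?thesis .
  qed
  then show ?thesis using that[of "B / m"] B m by simp
qed

lemma compact_map_finite_net:
  fixes i :: "'a::real_normed_vector \<Rightarrow> 'b::real_normed_vector" and j :: "'b \<Rightarrow> 'c::real_normed_vector"
  assumes comp: "compact_map UNIV norm euclidean i" and j: "bounded_linear j" and e: "0 < e"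
  obtains N where "finite N" "\<And>x. norm x \<le> R \<Longrightarrow> \<exists>y\<in>N. norm (j (i x) - y) < e"
proof -
  have "compact (j ` closure (i ` cball 0 R))"
    using j by (intro compact_continuous_image compact_closure_image_cball comp linear_continuous_on)
  then obtain N where N: "finite N" "j ` closure (i ` cball 0 R) \<subseteq> (\<Union>y\<in>N. ball y e)"
    unfolding compact_eq_totally_bounded using e by blast
  have "\<exists>y\<in>N. norm (j (i x) - y) < e" if "norm x \<le> R" for x
  proof -
    have "j (i x) \<in> j ` closure (i ` cball 0 R)" using that closure_subset by fastforce
    then show ?thesis using N(2) by (force simp: dist_norm norm_minus_commute)
  qed
  with N(1) show ?thesis by (rule that)
qed

text \<open>
  The fibres of \<open>g\<close> partition \<open>S\<close> into finitely many classes, each with an image of small diameter. One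
  representative of each class gives the centres, which moreover lie in the image, as the definition
  of total boundedness demands.
\<close>

lemma (in Metric_space) mtotally_bounded_imageI:
  assumes "f ` S \<subseteq> M"
    and "\<And>e. 0 < e \<Longrightarrow> \<exists>g :: 'b \<Rightarrow> 'c. finite (g ` S) \<and> (\<forall>x\<in>S. \<forall>y\<in>S. g x = g y \<longrightarrow> d (f x) (f y) < e)"
  shows "mtotally_bounded (f ` S)"
  unfolding mtotally_bounded_def
proof (intro allI impI)
  fix e :: real assume "0 < e"
  then obtain g :: "'b \<Rightarrow> 'c" where g: "finite (g ` S)" "\<And>x y. x \<in> S \<Longrightarrow> y \<in> S \<Longrightarrow> g x = g y \<Longrightarrow> d (f x) (f y) < e"
    using assms(2) by metis
  define R where "R = inv_into S g ` g ` S"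
  have RS: "R \<subseteq> S" by (auto simp: R_def inv_into_into)
  have "f x \<in> (\<Union>y\<in>f ` R. mball y e)" if "x \<in> S" for x
  proof -
    have "inv_into S g (g x) \<in> R" using that by (auto simp: R_def)
    moreover have "d (f (inv_into S g (g x))) (f x) < e"
      using that by (intro g) (auto simp: inv_into_into f_inv_into_f)
    ultimately show ?thesis using that RS assms(1) by (auto simp: subset_iff image_iff)
  qed
  then have "f ` S \<subseteq> (\<Union>y\<in>f ` R. mball y e)" by (rule image_subsetI)
  moreover have "finite (f ` R)" using g(1) by (simp add: R_def)
  moreover have "f ` R \<subseteq> f ` S" using RS by (rule image_mono)
  ultimately show "\<exists>K. finite K \<and> K \<subseteq> f ` S \<and> f ` S \<subseteq> (\<Union>x\<in>K. mball x e)"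
    by (intro exI[of _ "f ` R"] conjI)
qed

text \<open>
  The centres are taken from \<open>S\<close> itself: below, only points of the time scale are admissible.
\<close>

lemma bounded_real_finite_net:
  fixes S :: "real set"
  assumes "bounded S" "0 < \<delta>"
  obtains P where "finite P" "P \<subseteq> S" "S \<subseteq> (\<Union>c\<in>P. ball c \<delta>)"
proof -
  have comp: "compact (closure S)" using assms by simp
  have cover: "closure S \<subseteq> (\<Union>c\<in>S. ball c \<delta>)"
  proof
    fix x assume "x \<in> closure S"
    then obtain c where "c \<in> S" "dist c x < \<delta>"
      using assms(2) by (meson closure_approachable)
    then show "x \<in> (\<Union>c\<in>S. ball c \<delta>)" by auto
  qed
  show ?thesis
    by (rule compactE_image[OF comp open_ball cover], rule that, assumption+)
      (rule subset_trans[OF closure_subset])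
qed

section \<open>Bounded trajectories on a time scale\<close>

locale time_scale_interval =
  fixes T :: "real set" and a b :: real
  assumes closed_T: "closed T" and aT: "a \<in> T" and bT: "b \<in> T" and ab: "a < b"
begin

abbreviation H :: "real measure" where
  "H \<equiv> hilger_measure T a b"

lemma hilger: "is_hilger_measure T a b H"
  by (rule is_hilger_measure_hilger_measure[OF closed_T aT bT ab])

lemma finite_measure_H: "finite_measure H"
  using hilger by (simp add: is_hilger_measure_def)

lemma space_H: "space H = {a..<b} \<inter> T"
proof -
  have "sets H = sets (restrict_space borel ({a..<b} \<inter> T))"
    using hilger by (simp add: is_hilger_measure_def)
  then have "space H = space (restrict_space borel ({a..<b} \<inter> T))" by (rule sets_eq_imp_space_eq)
  then show ?thesis by (simp add: space_restrict_space)
qed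

lemma cell_in_sets_H:
  assumes "a \<le> c" "d \<le> b"
  shows "{c..<d} \<inter> T \<in> sets H"
proof -
  have "{c..<d} \<inter> T = ({a..<b} \<inter> T) \<inter> {c..<d}" using assms by auto
  then show ?thesis using hilger by (auto simp: is_hilger_measure_def sets_restrict_space)
qed

lemma emeasure_cell:
  assumes "c \<in> T" "d \<in> T" "a \<le> c" "c \<le> d" "d \<le> b"
  shows "emeasure H ({c..<d} \<inter> T) = ennreal (d - c)"
  using assms hilger by (cases "c = d") (auto simp: is_hilger_measure_def)

lemma has_strong_integral_delta_integral:
  assumes z: "strongly_measurable H z" "p_integral H p z < \<infinity>" "1 \<le> p" and t: "t \<in> {a..b} \<inter> T"
  shows "has_strong_integral H (\<lambda>s. indicator ({a..<t} \<inter> T) s *\<^sub>R z s) (delta_integral T a b t z)"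
  unfolding delta_integral_def
proof (rule has_strong_integral_exists)
  have A: "{a..<t} \<inter> T \<in> sets H" using t by (intro cell_in_sets_H) auto
  show "strongly_measurable H (\<lambda>s. indicator ({a..<t} \<inter> T) s *\<^sub>R z s)"
    by (rule strongly_measurable_indicator[OF z(1) A])
  have "(\<integral>\<^sup>+s. norm (indicator ({a..<t} \<inter> T) s *\<^sub>R z s) \<partial>H) \<le>
      ennreal 1 * emeasure H ({a..<t} \<inter> T) + ennreal (1 powr (1 - p)) * p_integral H p z"
    by (rule nn_integral_norm_le_p_integral[OF z(1) A _ z(3)]) simp
  also have "\<dots> < \<infinity>"
    using z t emeasure_cell[OF aT, of t] by simp
  finally show "(\<integral>\<^sup>+s. norm (indicator ({a..<t} \<inter> T) s *\<^sub>R z s) \<partial>H) < \<infinity>" .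
qed

text \<open>
  The uniform integrability estimate on \<open>[s,t)\<close>, whose measure is \<open>t - s\<close>. The number \<open>K\<close> stays free
  because it has to be chosen before \<open>t - s\<close> is made small.
\<close>

lemma delta_integral_diff_le:
  assumes z: "strongly_measurable H z" "p_integral H p z < \<infinity>" "1 \<le> p"
    and s: "s \<in> {a..b} \<inter> T" and t: "t \<in> {a..b} \<inter> T" and st: "s \<le> t" and K: "0 < K"
  shows "norm (delta_integral T a b t z - delta_integral T a b s z) \<le>
    K * (t - s) + K powr (1 - p) * p_norm H p z powr p"
proof -
  have "ennreal (norm (delta_integral T a b t z - delta_integral T a b s z)) \<le>
      (\<integral>\<^sup>+x. norm (indicator ({a..<t} \<inter> T) x *\<^sub>R z x - indicator ({a..<s} \<inter> T) x *\<^sub>R z x) \<partial>H)"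
    by (intro has_strong_integral_norm_le has_strong_integral_diff
        has_strong_integral_delta_integral[OF z] s t)
  also have "\<dots> = (\<integral>\<^sup>+x. norm (indicator ({s..<t} \<inter> T) x *\<^sub>R z x) \<partial>H)"
    using s st by (intro nn_integral_cong) (auto simp: indicator_def)
  also have "\<dots> \<le> ennreal K * emeasure H ({s..<t} \<inter> T) + ennreal (K powr (1 - p)) * p_integral H p z"
    using s t by (intro nn_integral_norm_le_p_integral z K cell_in_sets_H) auto
  also have "emeasure H ({s..<t} \<inter> T) = ennreal (t - s)"
    using s t st by (intro emeasure_cell) auto
  also have "ennreal K * ennreal (t - s) + ennreal (K powr (1 - p)) * p_integral H p z =
      ennreal (K * (t - s) + K powr (1 - p) * p_norm H p z powr p)"
    unfolding p_norm_powr[OF z(3,2)] using K st by (simp flip: ennreal_mult ennreal_plus)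
  finally show ?thesis
    using K st by (subst (asm) ennreal_le_iff) auto
qed

text \<open>
  The path \<open>U\<close> is the representative of \<open>i \<circ> u\<close> with values at every single time. The starting point
  and the derivative \<open>z\<close> are hidden: the estimates see them only through the bound \<open>C\<close> on the norm
  of \<open>z\<close>.
\<close>

definition bounded_trajectory ::
    "real \<Rightarrow> real \<Rightarrow> ('x::banach \<Rightarrow> 'y::banach) \<Rightarrow> real \<Rightarrow> (real \<Rightarrow> 'y) \<Rightarrow> (real \<Rightarrow> 'x) \<Rightarrow> bool" where
  "bounded_trajectory p q i C U u \<longleftrightarrow>
     strongly_measurable H u \<and> p_integral H p u < \<infinity> \<and> p_norm H p u \<le> C \<and>
     (AE t in H. U t = i (u t)) \<and>
     (\<exists>x z. strongly_measurable H z \<and> p_integral H q z < \<infinity> \<and> p_norm H q z \<le> C \<and>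
        (\<forall>t\<in>{a..b} \<inter> T. U t = x + delta_integral T a b t z))"

lemma evolution_graph_bounded_trajectory:
  assumes w: "w \<in> evolution_graph T a b p q i" and C: "evolution_norm T a b p q w \<le> C"
  shows "\<exists>U. bounded_trajectory p q i C U (class_rep (fst w))"
proof -
  obtain u z where [simp]: "w = (u, z)" by (cases w)
  obtain x U where u: "u \<in> Lp_space H p" and z: "z \<in> Lp_space H q"
    and U: "AE t in H. U t = i (class_rep u t)"
    "\<forall>t\<in>{a..b} \<inter> T. U t = x + delta_integral T a b t (class_rep z)"
    using w unfolding evolution_graph_def by auto
  have "p_norm H p (class_rep u) \<le> C" "p_norm H q (class_rep z) \<le> C"
    using C p_norm_nonneg[of H p "class_rep u"] p_norm_nonneg[of H q "class_rep z"]
    unfolding evolution_norm_def Lp_norm_def by simp_all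
  with U Lp_space_class_rep[OF u] Lp_space_class_rep[OF z] show ?thesis
    unfolding bounded_trajectory_def by auto
qed

text \<open>
  It is essential that \<open>\<delta>\<close> depends only on the bound \<open>C\<close>. For \<open>q = 1\<close> the claim fails in general, because
  the mass of \<open>z\<close> can concentrate.
\<close>

lemma bounded_trajectory_equicontinuous:
  assumes q: "1 < q" and e: "0 < e"
  obtains \<delta> where "0 < \<delta>"
    "\<And>U u s t. bounded_trajectory p q i C U u \<Longrightarrow> s \<in> {a..b} \<inter> T \<Longrightarrow> t \<in> {a..b} \<inter> T \<Longrightarrow>
       \<bar>t - s\<bar> < \<delta> \<Longrightarrow> norm (U t - U s) < e"
proof -
  define D where "D = C powr q + 1"
  have D: "0 < D" "C powr q \<le> D" by (auto simp: D_def add_nonneg_pos)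
  \<comment> \<open>\<open>K\<close> solves \<open>K powr (1 - q) * D = e / 2\<close>; this is where \<open>q \<noteq> 1\<close> enters.\<close>
  define K where "K = (e / (2 * D)) powr (1 / (1 - q))"
  have K: "0 < K" "K powr (1 - q) = e / (2 * D)"
    using e D q by (auto simp: K_def powr_powr)
  have ordered: "norm (U t - U s) < e"
    if traj: "bounded_trajectory p q i C U u" and s: "s \<in> {a..b} \<inter> T" and t: "t \<in> {a..b} \<inter> T"
      and st: "s \<le> t" "t - s < e / (2 * K)" for U u s t
  proof -
    obtain x z where z: "strongly_measurable H z" "p_integral H q z < \<infinity>" "p_norm H q z \<le> C"
      and U: "\<And>t. t \<in> {a..b} \<inter> T \<Longrightarrow> U t = x + delta_integral T a b t z"
      using traj unfolding bounded_trajectory_def by blast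
    have "norm (U t - U s) \<le> K * (t - s) + K powr (1 - q) * p_norm H q z powr q"
      using delta_integral_diff_le[OF z(1,2) _ s t st(1) K(1)] q by (simp add: U[OF s] U[OF t])
    also have "K * (t - s) < e / 2"
      using st K by (simp add: field_simps)
    also have "K powr (1 - q) * p_norm H q z powr q \<le> e / (2 * D) * D"
      unfolding K(2) using z(3) q e D p_norm_nonneg[of H q z]
      by (intro mult_left_mono order_trans[OF powr_mono2 D(2)]) auto
    also have "e / (2 * D) * D = e / 2" using D by simp
    finally show ?thesis by simp
  qed
  show ?thesis
  proof (rule that[of "e / (2 * K)"])
    show "0 < e / (2 * K)" using e K by simp
    show "norm (U t - U s) < e"
      if "bounded_trajectory p q i C U u" "s \<in> {a..b} \<inter> T" "t \<in> {a..b} \<inter> T" "\<bar>t - s\<bar> < e / (2 * K)"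
      for U u s t
      using ordered[of U u s t] ordered[of U u t s] that
      by (cases "s \<le> t") (auto simp: norm_minus_commute)
  qed
qed

text \<open>
  Either the time scale has a point in \<open>(t, t + \<delta>)\<close>, which serves as \<open>d\<close>, or it has a gap there; then
  \<open>d\<close> is the first point after the gap, possibly far away, and \<open>[t,d)\<close> contains no point of the time
  scale but \<open>t\<close>. In both cases the cell has positive measure \<open>d - t\<close>.
\<close>

lemma short_cell_exists:
  assumes t: "t \<in> T" "a \<le> t" "t < b" and \<delta>: "0 < \<delta>"
  obtains d where "d \<in> T" "t < d" "d \<le> b" "{t..<d} \<inter> T \<subseteq> {t..<t + \<delta>}"
proof (cases "\<exists>d\<in>T. t < d \<and> d \<le> b \<and> d < t + \<delta>")
  case True
  then show ?thesis using that by force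
next
  case False
  define d where "d = Inf (T \<inter> {t + \<delta>..b})"
  have b: "b \<in> T \<inter> {t + \<delta>..b}" using False t bT by force
  have bdd: "bdd_below (T \<inter> {t + \<delta>..b})" by (auto intro!: bdd_belowI[of _ "t + \<delta>"])
  have d: "d \<in> T \<inter> {t + \<delta>..b}"
    unfolding d_def using b bdd closed_T by (intro closed_contains_Inf closed_Int) auto
  have "{t..<d} \<inter> T \<subseteq> {t..<t + \<delta>}"
  proof
    fix s assume s: "s \<in> {t..<d} \<inter> T"
    have "\<not> t + \<delta> \<le> s"
    proof
      assume "t + \<delta> \<le> s"
      then have "d \<le> s" unfolding d_def using s d bdd by (intro cInf_lower) auto
      then show False using s by simp
    qed
    then show "s \<in> {t..<t + \<delta>}" using s by simp
  qed
  then show ?thesis using that[of d] d \<delta> by auto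
qed

text \<open>
  Chebyshev's inequality: were \<open>\<parallel>u\<parallel>\<^sup>p\<close> larger than \<open>(C\<^sup>p + 1) / (d - c)\<close> almost everywhere on the cell, which
  has measure \<open>d - c\<close>, its integral would exceed \<open>C\<^sup>p\<close>. The property \<open>P\<close> makes it possible to choose a time
  at which the path agrees with the state.
\<close>

lemma bounded_value_exists:
  assumes u: "strongly_measurable H u" "p_integral H p u < \<infinity>" "p_norm H p u \<le> C" and p: "1 \<le> p"
    and c: "c \<in> T" "a \<le> c" and d: "d \<in> T" "d \<le> b" and cd: "c < d"
    and P: "AE s in H. P s"
  obtains s where "s \<in> {c..<d} \<inter> T" "P s" "norm (u s) \<le> ((C powr p + 1) / (d - c)) powr (1 / p)"
proof -
  define R where "R = (C powr p + 1) / (d - c)"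
  have R: "0 < R" using cd by (simp add: R_def add_nonneg_pos)
  have "\<exists>s\<in>{c..<d} \<inter> T. P s \<and> norm (u s) powr p \<le> R"
  proof (rule ccontr)
    assume "\<not> ?thesis"
    then have no: "P s \<Longrightarrow> s \<in> {c..<d} \<inter> T \<Longrightarrow> R < norm (u s) powr p" for s by force
    have "ennreal (R * (d - c)) = (\<integral>\<^sup>+s. ennreal R * indicator ({c..<d} \<inter> T) s \<partial>H)"
      using c d cd R emeasure_cell[of c d]
      by (subst nn_integral_cmult_indicator) (auto simp: cell_in_sets_H ennreal_mult)
    also have "\<dots> \<le> p_integral H p u"
      unfolding p_integral_def
    proof (rule nn_integral_mono_AE, use P in eventually_elim)
      case (elim s)
      then show ?case using no[of s] by (auto simp: indicator_def intro!: ennreal_leI)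
    qed
    also have "\<dots> \<le> ennreal (C powr p)"
      unfolding p_norm_powr[OF p u(2)] using u(3) p p_norm_nonneg[of H p u]
      by (intro ennreal_leI powr_mono2) auto
    finally have "R * (d - c) \<le> C powr p" by simp
    then show False using cd by (simp add: R_def)
  qed
  then obtain s where s: "s \<in> {c..<d} \<inter> T" "P s" "norm (u s) powr p \<le> R" by blast
  have "norm (u s) = (norm (u s) powr p) powr (1 / p)" using p by (simp add: powr_powr)
  also have "\<dots> \<le> R powr (1 / p)" using s p by (intro powr_mono2) auto
  finally show ?thesis using that s unfolding R_def by blast
qed

text \<open>
  \<open>U t\<close> is compared with \<open>U s\<close> for a time \<open>s\<close> of a short cell at \<open>t\<close> at which the state is bounded in the
  smallest space. While \<open>s\<close> depends on the trajectory, the bound does not.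
\<close>

lemma bounded_trajectory_values_finite_net:
  fixes i :: "'x::banach \<Rightarrow> 'y::banach" and j :: "'y \<Rightarrow> 'z::banach"
  assumes comp: "compact_map UNIV norm euclidean i" and j: "bounded_linear j"
    and p: "1 \<le> p" and q: "1 < q" and t: "t \<in> {a..<b} \<inter> T" and e: "0 < e"
  shows "\<exists>N. finite N \<and> (\<forall>U u. bounded_trajectory p q (j \<circ> i) C U u \<longrightarrow> (\<exists>y\<in>N. norm (U t - y) < e))"
proof -
  obtain \<delta> where \<delta>: "0 < \<delta>"
    and equi: "\<And>U u s t. bounded_trajectory p q (j \<circ> i) C U u \<Longrightarrow> s \<in> {a..b} \<inter> T \<Longrightarrow> t \<in> {a..b} \<inter> T \<Longrightarrow>
       \<bar>t - s\<bar> < \<delta> \<Longrightarrow> norm (U t - U s) < e / 2"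
    using bounded_trajectory_equicontinuous[OF q, of "e / 2" p "j \<circ> i" C] e by auto
  obtain d where d: "d \<in> T" "t < d" "d \<le> b" "{t..<d} \<inter> T \<subseteq> {t..<t + \<delta>}"
    using short_cell_exists[of t \<delta>] t \<delta> by auto
  obtain N where N: "finite N"
    "\<And>x. norm x \<le> ((C powr p + 1) / (d - t)) powr (1 / p) \<Longrightarrow> \<exists>y\<in>N. norm (j (i x) - y) < e / 2"
    using compact_map_finite_net[OF comp j, of "e / 2"] e by (metis half_gt_zero)
  have "\<exists>y\<in>N. norm (U t - y) < e" if traj: "bounded_trajectory p q (j \<circ> i) C U u" for U u
  proof -
    have u: "strongly_measurable H u" "p_integral H p u < \<infinity>" "p_norm H p u \<le> C"
      and AE: "AE s in H. U s = (j \<circ> i) (u s)"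
      using traj unfolding bounded_trajectory_def by auto
    obtain s where s: "s \<in> {t..<d} \<inter> T" "U s = (j \<circ> i) (u s)"
      "norm (u s) \<le> ((C powr p + 1) / (d - t)) powr (1 / p)"
      using bounded_value_exists[OF u p _ _ d(1,3,2) AE] t by auto
    obtain y where y: "y \<in> N" "norm (U s - y) < e / 2"
      using N(2)[OF s(3)] s(2) by auto
    have "norm (U t - U s) < e / 2"
    proof (rule equi[OF traj])
      show "\<bar>t - s\<bar> < \<delta>" using s(1) d(4) by force
    qed (use s t d in auto)
    then have "norm (U t - y) < e"
      using norm_triangle_ineq[of "U t - U s" "U s - y"] y(2) by simp
    with y(1) show ?thesis by blast
  qed
  with N(1) show ?thesis by blast
qed

text \<open>
  The class of a trajectory is recorded by choosing, for each time \<open>c\<close> of a finite \<open>\<delta>\<close>-net, a point near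
  \<open>U c\<close> in a finite net of all possible values. The comparison of two trajectories of the same class at
  an arbitrary time consists of four steps of length \<open>e / 4\<close>.
\<close>

lemma bounded_trajectories_finite_cover:
  fixes i :: "'x::banach \<Rightarrow> 'y::banach" and j :: "'y \<Rightarrow> 'z::banach"
  assumes comp: "compact_map UNIV norm euclidean i" and j: "bounded_linear j"
    and p: "1 \<le> p" and q: "1 < q" and e: "0 < e"
    and traj: "\<And>w. w \<in> S \<Longrightarrow> bounded_trajectory p q (j \<circ> i) C (U w) (u w)"
  shows "\<exists>g :: 's \<Rightarrow> real \<Rightarrow> 'z. finite (g ` S) \<and>
    (\<forall>w\<in>S. \<forall>w'\<in>S. g w = g w' \<longrightarrow> (\<forall>t\<in>{a..<b} \<inter> T. norm (U w t - U w' t) \<le> e))"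
proof -
  obtain \<delta> where \<delta>: "0 < \<delta>"
    and equi: "\<And>U u s t. bounded_trajectory p q (j \<circ> i) C U u \<Longrightarrow> s \<in> {a..b} \<inter> T \<Longrightarrow> t \<in> {a..b} \<inter> T \<Longrightarrow>
       \<bar>t - s\<bar> < \<delta> \<Longrightarrow> norm (U t - U s) < e / 4"
    using bounded_trajectory_equicontinuous[OF q, of "e / 4" p "j \<circ> i" C] e by auto
  obtain P where P: "finite P" "P \<subseteq> {a..<b} \<inter> T" "{a..<b} \<inter> T \<subseteq> (\<Union>c\<in>P. ball c \<delta>)"
  proof (rule bounded_real_finite_net[OF _ \<delta>])
    show "bounded ({a..<b} \<inter> T)" by (rule bounded_subset[OF bounded_closed_interval[of a b]]) auto
  qed
  have "\<exists>N. finite N \<and> (\<forall>w\<in>S. \<exists>y\<in>N. norm (U w c - y) < e / 4)" if "c \<in> P" for c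
    using bounded_trajectory_values_finite_net[OF comp j p q, of c "e / 4" C] that P(2) e traj
    by (metis (no_types, lifting) subsetD divide_pos_pos zero_less_numeral)
  then obtain N where N: "\<And>c. c \<in> P \<Longrightarrow> finite (N c)"
    "\<And>c w. c \<in> P \<Longrightarrow> w \<in> S \<Longrightarrow> \<exists>y\<in>N c. norm (U w c - y) < e / 4"
    by metis
  define g where "g w = restrict (\<lambda>c. SOME y. y \<in> N c \<and> norm (U w c - y) < e / 4) P" for w
  have g: "g w c \<in> N c" "norm (U w c - g w c) < e / 4" if "c \<in> P" "w \<in> S" for c w
    using someI_ex[of "\<lambda>y. y \<in> N c \<and> norm (U w c - y) < e / 4"] N(2)[OF that] that
    by (auto simp: g_def)
  have "g ` S \<subseteq> PiE P N"
    using g(1) by (auto simp: g_def PiE_iff)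
  then have fin: "finite (g ` S)"
    using P(1) N(1) by (rule finite_subset[OF _ finite_PiE])
  have "norm (U w t - U w' t) \<le> e" if w: "w \<in> S" "w' \<in> S" "g w = g w'" and t: "t \<in> {a..<b} \<inter> T" for w w' t
  proof -
    obtain c where c: "c \<in> P" "\<bar>t - c\<bar> < \<delta>"
      using P(3) t by (force simp: dist_real_def)
    have near: "norm (U v t - U v c) < e / 4" if "v \<in> S" for v
      using c P(2) t by (intro equi[OF traj[OF that]]) auto
    have "U w t - U w' t =
        (U w t - U w c) + ((U w c - g w c) - (U w' c - g w' c)) - (U w' t - U w' c)"
      using w(3) by simp
    also have "norm \<dots> \<le> norm (U w t - U w c) + (norm (U w c - g w c) + norm (U w' c - g w' c))
        + norm (U w' t - U w' c)"
      by (rule order_trans[OF norm_triangle_ineq4 add_right_mono[OF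
            order_trans[OF norm_triangle_ineq add_left_mono[OF norm_triangle_ineq4]]]])
    also have "\<dots> \<le> e"
      using near[OF w(1)] near[OF w(2)] g(2)[OF c(1) w(1)] g(2)[OF c(1) w(2)] by linarith
    finally show ?thesis .
  qed
  with fin show ?thesis by blast
qed

end

theorem corollary5p7:
  fixes T :: "real set" and a b p0 p1 :: real
    and i0B :: "'b0::banach \<Rightarrow> 'b::banach" and iB1 :: "'b \<Rightarrow> 'b1::banach"
  assumes "time_scale T" and "a \<in> T" and "b \<in> T" and "a < b"
    and "reflexive_space TYPE('b0)" and "reflexive_space TYPE('b1)"
    and "bounded_linear i0B" and "inj i0B" and "compact_map UNIV norm euclidean i0B"
    and "bounded_linear iB1" and "inj iB1"
    and "1 < p0" and "1 < p1"
  shows "compact_map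
           (evolution_graph T a b p0 p1 (iB1 \<circ> i0B))
           (evolution_norm T a b p0 p1)
           (Lp_topology (hilger_measure T a b) p0)
           (state_projection T a b i0B)"
proof -
  note i = assms(7) and comp = assms(9) and j = assms(10,11) and q = assms(13)
  have p: "1 \<le> p0" using assms(12) by simp
  interpret time_scale_interval T a b
    using assms(1-4) by unfold_locales (auto simp: time_scale_def)
  interpret Lp: Metric_space "Lp_space H p0" "Lp_dist H p0 :: (real \<Rightarrow> 'b) set \<Rightarrow> _"
    by (rule Metric_space_Lp[OF p])
  let ?W = "evolution_graph T a b p0 p1 (iB1 \<circ> i0B)"
  let ?\<pi> = "state_projection T a b i0B :: (real \<Rightarrow> 'b0) set \<times> (real \<Rightarrow> 'b1) set \<Rightarrow> _"
  have \<pi>: "?\<pi> w = ae_class H (\<lambda>t. i0B (class_rep (fst w) t))" for w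
    by (cases w) (simp add: state_projection_def comp_def)
  obtain B where B: "0 \<le> B" "\<And>x. norm (i0B x) \<le> B * norm x"
    using bounded_linear.nonneg_bounded[OF i] by (metis mult.commute)
  have \<pi>_Lp: "?\<pi> w \<in> Lp_space H p0" if "w \<in> ?W" for w
  proof -
    have "fst w \<in> Lp_space H p0" using that by (auto simp: evolution_graph_def)
    note u = Lp_space_class_rep[OF this]
    have "p_integral H p0 (\<lambda>t. i0B (class_rep (fst w) t)) < \<infinity>"
      by (rule p_norm_le_affine(1)[OF finite_measure_H u(1) p u(2) B(1), of 0]) (use B in auto)
    then show ?thesis
      unfolding \<pi> Lp_space_def using strongly_measurable_bounded_linear[OF u(1) i] by blast
  qed
  have "compactin Lp.mtopology (Lp.mtopology closure_of (?\<pi> ` S))"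
    if S: "S \<subseteq> ?W" and C: "\<And>w. w \<in> S \<Longrightarrow> evolution_norm T a b p0 p1 w \<le> C" for S C
  proof -
    have "\<exists>U. bounded_trajectory p0 p1 (iB1 \<circ> i0B) C U (class_rep (fst w))" if "w \<in> S" for w
      using evolution_graph_bounded_trajectory[OF _ C[OF that]] S that by blast
    then obtain U where traj: "\<And>w. w \<in> S \<Longrightarrow> bounded_trajectory p0 p1 (iB1 \<circ> i0B) C (U w) (class_rep (fst w))"
      by metis
    \<comment> \<open>Positive upper bounds, so that it is possible to divide by them.\<close>
    define D where "D = \<bar>C\<bar> + 1"
    define m where "m = measure H (space H) powr (1 / p0) + 1"
    have D: "0 < D" "C < D" and m: "0 < m" "measure H (space H) powr (1 / p0) \<le> m"
      by (auto simp: D_def m_def add_nonneg_pos)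
    have "Lp.mtotally_bounded (?\<pi> ` S)"
    proof (rule Lp.mtotally_bounded_imageI)
      show "?\<pi> ` S \<subseteq> Lp_space H p0" using \<pi>_Lp S by blast
      fix e :: real assume e: "0 < e"
      \<comment> \<open>The two terms of Ehrling's inequality will contribute \<open>e / 2\<close> and \<open>e / 4\<close>.\<close>
      define e1 where "e1 = e / (4 * D)"
      have e1: "0 < e1" using e D by (simp add: e1_def)
      obtain E where E: "0 < E" "\<And>x. norm (i0B x) \<le> e1 * norm x + E * norm (iB1 (i0B x))"
        using Ehrling_inequality[OF i comp j e1] by blast
      define e2 where "e2 = e / (4 * E * m)"
      have e2: "0 < e2" using e E m by (simp add: e2_def)
      obtain g :: "_ \<Rightarrow> real \<Rightarrow> 'b1" where g: "finite (g ` S)"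
        "\<And>w w' t. w \<in> S \<Longrightarrow> w' \<in> S \<Longrightarrow> g w = g w' \<Longrightarrow> t \<in> {a..<b} \<inter> T \<Longrightarrow> norm (U w t - U w' t) \<le> e2"
        using bounded_trajectories_finite_cover[where S = S and U = U, OF comp j(1) p q e2 traj] by blast
      have "Lp_dist H p0 (?\<pi> w) (?\<pi> w') < e" if w: "w \<in> S" "w' \<in> S" "g w = g w'" for w w'
      proof -
        let ?u = "class_rep (fst w)" and ?u' = "class_rep (fst w')"
        have u: "strongly_measurable H ?u" "p_integral H p0 ?u < \<infinity>" "p_norm H p0 ?u \<le> C"
          "AE t in H. U w t = iB1 (i0B (?u t))"
          using traj[OF w(1)] unfolding bounded_trajectory_def by auto
        have u': "strongly_measurable H ?u'" "p_integral H p0 ?u' < \<infinity>" "p_norm H p0 ?u' \<le> C"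
          "AE t in H. U w' t = iB1 (i0B (?u' t))"
          using traj[OF w(2)] unfolding bounded_trajectory_def by auto
        have "p_norm H p0 (\<lambda>t. ?u t - ?u' t) \<le> p_norm H p0 ?u + p_norm H p0 ?u'"
          by (rule p_norm_add_le(2)[OF u(1) u'(1) p u(2) u'(2)]) (simp add: norm_triangle_ineq4)
        then have diff: "p_norm H p0 (\<lambda>t. ?u t - ?u' t) \<le> 2 * D" using u(3) u'(3) D by linarith
        have "AE t in H. norm (i0B (?u t) - i0B (?u' t)) \<le> e1 * norm (?u t - ?u' t) + E * e2"
          using u(4) u'(4) AE_space
        proof eventually_elim
          case (elim t)
          have "norm (i0B (?u t) - i0B (?u' t)) \<le> e1 * norm (?u t - ?u' t) + E * norm (iB1 (i0B (?u t - ?u' t)))"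
            using E(2)[of "?u t - ?u' t"] by (simp add: linear_simps(2)[OF i])
          also have "iB1 (i0B (?u t - ?u' t)) = U w t - U w' t"
            using elim by (simp add: linear_simps(2)[OF i] linear_simps(2)[OF j(1)])
          also have "norm \<dots> \<le> e2" using g(2)[OF w] elim(3) by (simp add: space_H)
          finally show ?case using E by simp
        qed
        from p_norm_le_affine(2)[OF finite_measure_H Lp_diff(1)[OF u(1,2) u'(1,2) p] p
            Lp_diff(2)[OF u(1,2) u'(1,2) p] _ _ this]
        have "p_norm H p0 (\<lambda>t. i0B (?u t) - i0B (?u' t)) \<le>
            e1 * p_norm H p0 (\<lambda>t. ?u t - ?u' t) + E * e2 * measure H (space H) powr (1 / p0)"
          using e1 E e2 by simp
        also have "\<dots> \<le> e1 * (2 * D) + E * e2 * m"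
          using e1 E e2 diff m by (intro add_mono mult_left_mono) auto
        also have "\<dots> = 3 / 4 * e" using D E m by (simp add: e1_def e2_def field_simps)
        also have "\<dots> < e" using e by simp
        finally show ?thesis by (simp add: \<pi> Lp_dist_ae_class)
      qed
      with g(1) show "\<exists>g :: _ \<Rightarrow> real \<Rightarrow> 'b1. finite (g ` S) \<and>
          (\<forall>w\<in>S. \<forall>w'\<in>S. g w = g w' \<longrightarrow> Lp_dist H p0 (?\<pi> w) (?\<pi> w') < e)"
        by blast
    qed
    then show ?thesis
      using Lp.mtotally_bounded_eq_compact_closure_of[OF mcomplete_Lp[OF p]] by blast
  qed
  note compactin = this
  show ?thesis
    unfolding compact_map_def Lp_topology_def Lp.topspace_mtopology
  proof (intro conjI Pi_I allI impI)
    fix S assume "S \<subseteq> ?W" and "\<exists>C. \<forall>w\<in>S. evolution_norm T a b p0 p1 w \<le> C"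
    then obtain C where "\<And>w. w \<in> S \<Longrightarrow> evolution_norm T a b p0 p1 w \<le> C" by blast
    then show "compactin Lp.mtopology (Lp.mtopology closure_of (?\<pi> ` S))"
      by (rule compactin[OF \<open>S \<subseteq> ?W\<close>])
  qed (rule \<pi>_Lp)
qed

end
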